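(* Let $W$ be a lower-bounded generalized $g$-twisted $V$-module generated by a nonzero element $w$ (for example, $\widehat M^{[g]}_B$ when $M$ is a one-dimensional space and $B$ is less than or equal to the real part of the weight of the elements of $M$). Then there exists a maximal submodule $J$ of $W$ such that $J$ does not contain $w$ and the quotient $W/J$ is irreducible.
   Context: $\mathbb N=\{0,1,2,\dots\}$. $V$ is a grading-restricted vertex superalgebra: a $\frac12\mathbb Z\times\mathbb Z_2$-graded complex vector space (weight $\mathrm{wt}$, fermion number $|\cdot|$) $V=\coprod_n V_{(n)}$ with $\dim V_{(n)}<\infty$, $V_{(n)}=0$ for $n$ sufficiently negative, an even vacuum $\mathbf 1\in V_{(0)}$, an even map $Y_V:V\otimes V\to V((x))$, operators $L_V(0)$ (equal to $n$ on $V_{(n)}$) and $L_V(-1)$, satisfying the vacuum and creation properties, the super Jacobi identity, $[L_V(0),Y_V(v,x)]=x\frac{d}{dx}Y_V(v,x)+Y_V(L_V(0)v,x)$ and $\frac{d}{dx}Y_V(v,x)=Y_V(L_V(-1)v,x)=[L_V(-1),Y_V(v,x)]$. $g$ is an automorphism of $V$ (bijection preserving gradings, $\mathbf 1$, $Y_V$, commuting with $L_V(-1)$). $P_V=\{\alpha\in\mathbb C:0\le\Re\alpha<1,\ e^{2\pi i\alpha}\text{ is an eigenvalue of }g\}$, $V^{[\alpha]}$ is the generalized $e^{2\pi i\alpha}$-eigenspace, $V=\coprod_{\alpha\in P_V}V^{[\alpha]}$, $g=e^{2\pi i\mathcal L_g}$ with $\mathcal L_g=\mathcal S_g+\mathcal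 N_g$, $\mathcal S_g=\alpha$ on $V^{[\alpha]}$ and $\mathcal N_g$ (locally) nilpotent. A lower-bounded generalized $g$-twisted $V$-module is $W=\coprod_{n\in\mathbb C,s\in\mathbb Z_2,[\alpha]\in\mathbb C/\mathbb Z}W^{s;[\alpha]}_{[n]}$ (weight, fermion number, $g$-weight), $W_{[n]}=0$ for $\Re n$ sufficiently negative, with an action of $g=e^{2\pi i\mathcal L_g}$, $\mathcal L_g=\mathcal S_g+\mathcal N_g$ (semisimple and nilpotent parts), $W^{[\alpha]}$ being the generalized $e^{2\pi i\alpha}$-eigenspace of $g$; operators $L_W(0)$, $L_W(-1)$, $W_{[n]}$ being the generalized $n$-eigenspace of $L_W(0)$, $[L_W(0),L_W(-1)]=L_W(-1)$; and an even linear map $Y^g_W:V\otimes W\to W\{x\}[\log x]$, $Y_W^g(v,x)w=\sum_{n\in\mathbb C,k\in\mathbb N}(Y_W^g)_{n,k}(v)w\,x^{-n-1}(\log x)^k$, such that: $Y_W^g(\mathbf 1,x)=1_W$; $gY_W^g(v,x)w=Y_W^g(gv,x)gw$; $[L_W(0),Y_W^g(v,x)]=x\frac{d}{dx}Y_W^g(v,x)+Y_W^g(L_V(0)v,x)$; $\frac{d}{dx}Y_W^g(v,x)=Y_W^g(L_V(-1)v,x)=[L_W(-1),Y_W^g(v,x)]$; equivariance $(Y^g_W)^{p+1}(gv,z)=(Y_W^g)^p(v,z)$, where $(Y_W^g)^p(v,z)$ ($p\in\mathbb Z$, $z\in\mathbb C^\times$) is obtained by $x^n\mapsto e^{nl_p(z)}$,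 $\log x\mapsto l_p(z)=\log|z|+i\arg z+2\pi ip$, $0\le\arg z<2\pi$; duality: for $u,v\in V$, $w\in W$, $w'\in W'$ (graded dual) there is $f=\sum a_{ijkl}z_1^{m_i}z_2^{n_j}(\log z_1)^k(\log z_2)^l(z_1-z_2)^{-t}$ (finite sum) such that $\langle w',(Y_W^g)^p(u,z_1)(Y_W^g)^p(v,z_2)w\rangle$, $(-1)^{|u||v|}\langle w',(Y_W^g)^p(v,z_2)(Y_W^g)^p(u,z_1)w\rangle$, $\langle w',(Y_W^g)^p(Y_V(u,z_1-z_2)v,z_2)w\rangle$ converge absolutely for $|z_1|>|z_2|>0$, $|z_2|>|z_1|>0$, $|z_2|>|z_1-z_2|>0$ respectively, to the branch of $f$ given by $\log z_j=l_p(z_j)$ (for the third, when $|\arg z_1-\arg z_2|<\pi/2$). A submodule is a graded subspace invariant under all $(Y_W^g)_{n,k}(v)$, $L_W(0)$, $L_W(-1)$ and $g$; $W$ is irreducible if $W\ne0$ and its only submodules are $0$ and $W$. $W$ is generated by a subset $S$ if $W$ is spanned by the coefficients of $Y_W^g(v,x)L_W(-1)^pL_W(0)^qw$, $v\in V$, $p,q\in\mathbb N$, $w\in S$. Generating fields of $V$: $\phi^i(x)=Y_V(\phi^i_{-1}\mathbf 1,x)=\sum_{n\in\mathbb Z}\phi^i_nx^{-n-1}$, $i\in I$, generate $V$; each $\phi^i_{-1}\mathbf 1$ is homogeneous of weight $\mathrm{wt}\,\phi^i$ and fermion number $|\phi^i|$, lies in $V^{[\alpha^i]}$, $\alpha^i\in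 P_V$, and $\mathcal N_g\phi^i_{-1}\mathbf 1$ is $0$ or equals $\phi^{\mathcal N_g(i)}_{-1}\mathbf 1$ for some $\mathcal N_g(i)\in I$. Expansions: $(x_1-x_2)^\beta$, $\log(x_1-x_2)$ are expanded in nonnegative powers of $x_2$; $(-x_2+x_1)^\beta$, $\log(-x_2+x_1)$ in nonnegative powers of $x_1$, with $(-x_2)^\beta=e^{\pi i\beta}x_2^\beta$, $\log(-x_2)=\log x_2+\pi i$. Construction of $\widehat M^{[g]}_B$. $M$ is a $\mathbb Z_2$-graded space with an action of $g=e^{2\pi i\mathcal L_g}$ ($\mathcal L_g=\mathcal S_g+\mathcal N_g$, semisimple and nilpotent parts) and an operator $L_M(0)=L_M(0)_S+L_M(0)_N$ (semisimple and nilpotent parts); $M$ is a direct sum of generalized eigenspaces of $L_M(0)$, with real parts of eigenvalues (weights) bounded below by $B\in\mathbb R$; $\{w^a\}_{a\in A}$ is a basis of $M$ homogeneous in weight, fermion number, $g$-weight, with $L_M(0)_Nw^a=w^{L_M(0)_N(a)}$, where $L_M(0)_N(a)\in A$ or $w^{L_M(0)_N(a)}:=0$. Let $\hat V=\coprod_{i,k}\mathbb C\mathcal N_g^k\phi^i_{-1}\mathbf 1\otimes t^{\alpha^i}\mathbb C[t,t^{-1}]\oplus\mathbb CL_0\oplus\mathbb CL_{-1}$, $\hat\phi^i(x)=\sum_{n\in\alpha^i+\mathbb Z}((x^{-\mathcal N_g}\phi^i_{-1}\mathbf 1)\otimes t^n)x^{-n-1}$, and let $U$ be the tensor algebra of $\hat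 V$ modulo the ideal generated by the coefficients of $(x_1-x_2)^{M_{ij}}(\hat\phi^i(x_1)\hat\phi^j(x_2)-(-1)^{|\phi^i||\phi^j|}\hat\phi^j(x_2)\hat\phi^i(x_1))$, $[L_0,\hat\phi^i(x)]-x\frac{d}{dx}\hat\phi^i(x)-(\mathrm{wt}\,\phi^i)\hat\phi^i(x)$, $[L_{-1},\hat\phi^i(x)]-\frac{d}{dx}\hat\phi^i(x)$, with $M_{ij}$ the smallest positive integer such that $x^{M_{ij}}Y_V(\phi^i_{-1}\mathbf 1,x)\phi^j_{-1}\mathbf 1\in V[[x]]$. Let $\widetilde M=\coprod_{\alpha\in P_V}U\otimes(M\otimes t^\alpha\mathbb C[t,t^{-1}])\otimes V^{[\alpha]}$, where $\phi^i(x),L(0),L(-1)$ act by left multiplication by $\hat\phi^i(x),L_0,L_{-1}$, and $\psi^a(x)v=\sum_{n\in\alpha+\mathbb Z}(w^a\otimes t^n)\otimes x^{-\mathcal N_g}v\,x^{-n-1}$ for $v\in V^{[\alpha]}$; subscripts $n,k$ denote coefficients of $x^{-n-1}(\log x)^k$. $\widehat M^{[g]}_B$ is the quotient of $\widetilde M$ by the $U$-submodule generated by: (i) $\psi^a_{n,0}\mathbf 1$, $n\notin-\mathbb N-1$; (ii) $\phi^{i_1}_{n_1,k_1}\cdots\phi^{i_l}_{n_l,k_l}L(0)^pL(-1)^q\psi^a_{n,k}v$ ($v$ homogeneous) with $\Re(\sum_j(\mathrm{wt}\,\phi^{i_j}-n_j-1)+q+\mathrm{wt}\,w^a-n-1+\mathrm{wt}\,v)<B$;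 (iii) the coefficients of $(x_1-x_2)^{\alpha^i+M_{ia}}(x_1-x_2)^{\mathcal N_g}\phi^i(x_1)(x_1-x_2)^{-\mathcal N_g}\psi^a(x_2)v-(-1)^{|\phi^i||w^a|}(-x_2+x_1)^{\alpha^i+M_{ia}}\psi^a(x_2)(-x_2+x_1)^{\mathcal N_g}\phi^i(x_1)(-x_2+x_1)^{-\mathcal N_g}v$ (in the second term $\phi^i(x_1)$ is the field of $V$; conjugation by $(\cdot)^{\mathcal N_g}$ means $\sum_p\frac1{p!}(\log(\cdot))^p\phi^{\mathcal N_g^p(i)}(x_1)$), with $M_{ia}$ the smallest positive integer greater than $\mathrm{wt}\,\phi^i-1+\Re(\mathrm{wt}\,w^a)-B-\Re(\alpha^i)$; (iv) the coefficients of $L(0)\psi^a(x)v-\psi^a(x)L_V(0)v-x\frac{d}{dx}\psi^a(x)v-(\mathrm{wt}\,w^a)\psi^a(x)v-\psi^{L_M(0)_N(a)}(x)v$ and $L(-1)\psi^a(x)v-\psi^a(x)L_V(-1)v-\frac{d}{dx}\psi^a(x)v$. With the induced operators (and $g$, fermion numbers induced from $V$ and $M$) it is a lower-bounded generalized $g$-twisted $V$-module with $Y^g(\phi^i_{-1}\mathbf 1,x)=\phi^i_{\widehat M^{[g]}_B}(x)$; when $M=\mathbb Cw^a$ the generator is $w=(\psi^a_{\widehat M^{[g]}_B})_{-1,0}\mathbf 1$. *)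

theory Defs
  imports
    "HOL-Analysis.Analysis"
    "HOL-Algebra.Algebraic_Closure_Type"
    "HOL-Library.Z2"
begin

section \<open>Complex vector spaces with carriers\<close>

text \<open>
  Complex vector spaces are modules in the sense of HOL-Algebra over the ring of complex numbers.
  Explicit carriers are used because the quotient of a module by a submodule, a set of
  cosets, is again such an object. The fields \<open>mult\<close> and \<open>one\<close> inherited from the record type of
  rings play no role. Linear operators are HOL functions whose values outside the
  carrier are irrelevant.
\<close>

abbreviation complex_ring :: "complex ring"
  where "complex_ring \<equiv> ring_of_type_algebra"

abbreviation complex_space :: "(complex, 'a, 'm) module_scheme \<Rightarrow> bool"
  where "complex_space M \<equiv> module complex_ring M"

abbreviation subspace_of :: "'a set \<Rightarrow> (complex, 'a, 'm) module_scheme \<Rightarrow> bool"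
  where "subspace_of H M \<equiv> submodule H complex_ring M"

definition linspan :: "(complex, 'a, 'm) module_scheme \<Rightarrow> 'a set \<Rightarrow> 'a set"
  where "linspan M S = (\<lambda>H. subspace_of H M) hull S"

definition linear_op :: "(complex, 'a, 'm) module_scheme \<Rightarrow> ('a \<Rightarrow> 'a) \<Rightarrow> bool"
  where "linear_op M T \<longleftrightarrow>
    (\<forall>x\<in>carrier M. T x \<in> carrier M) \<and>
    (\<forall>x\<in>carrier M. \<forall>y\<in>carrier M. T (x \<oplus>\<^bsub>M\<^esub> y) = T x \<oplus>\<^bsub>M\<^esub> T y) \<and>
    (\<forall>c. \<forall>x\<in>carrier M. T (c \<odot>\<^bsub>M\<^esub> x) = c \<odot>\<^bsub>M\<^esub> T x)"

definition linear_functional :: "(complex, 'a, 'm) module_scheme \<Rightarrow> ('a \<Rightarrow> complex) \<Rightarrow> bool"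
  where "linear_functional M \<phi> \<longleftrightarrow>
    (\<forall>x\<in>carrier M. \<forall>y\<in>carrier M. \<phi> (x \<oplus>\<^bsub>M\<^esub> y) = \<phi> x + \<phi> y) \<and>
    (\<forall>c. \<forall>x\<in>carrier M. \<phi> (c \<odot>\<^bsub>M\<^esub> x) = c * \<phi> x)"

text \<open>The sum of a family with finitely many nonzero members, over a possibly infinite index set.\<close>

definition fin_supp_sum ::
    "(complex, 'a, 'm) module_scheme \<Rightarrow> ('i \<Rightarrow> 'a) \<Rightarrow> 'i set \<Rightarrow> 'a"
  where "fin_supp_sum M f I = finsum M f {i \<in> I. f i \<noteq> \<zero>\<^bsub>M\<^esub>}"

text \<open>The subset \<open>D\<close> of \<open>M\<close> is the (internal) direct sum of the subspaces \<open>C i\<close>, \<open>i \<in> I\<close>.\<close>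

definition direct_sum_on ::
    "(complex, 'a, 'm) module_scheme \<Rightarrow> 'a set \<Rightarrow> 'i set \<Rightarrow> ('i \<Rightarrow> 'a set) \<Rightarrow> bool"
  where "direct_sum_on M D I C \<longleftrightarrow>
    (\<forall>i\<in>I. subspace_of (C i) M \<and> C i \<subseteq> D) \<and>
    (\<forall>x\<in>D. \<exists>!f. f \<in> PiE I C \<and> finite {i \<in> I. f i \<noteq> \<zero>\<^bsub>M\<^esub>} \<and> x = fin_supp_sum M f I)"

definition gen_eigenspace ::
    "(complex, 'a, 'm) module_scheme \<Rightarrow> ('a \<Rightarrow> 'a) \<Rightarrow> complex \<Rightarrow> 'a set"
  where "gen_eigenspace M T c =
    {x \<in> carrier M. \<exists>k. ((\<lambda>y. T y \<ominus>\<^bsub>M\<^esub> c \<odot>\<^bsub>M\<^esub> y) ^^ k) x = \<zero>\<^bsub>M\<^esub>}"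

text \<open>\<open>(-1)\<^sup>s\<^sup>t\<close> for fermion numbers \<open>s, t\<close>\<close>

definition super_sign :: "bit \<Rightarrow> bit \<Rightarrow> complex"
  where "super_sign s t = (if s * t = 1 then - 1 else 1)"


section \<open>Grading-restricted vertex superalgebras\<close>

text \<open>
  \<open>modeV V v n\<close> is the coefficient \<open>v\<^sub>n\<close> of \<open>x\<^sup>-\<^sup>n\<^sup>-\<^sup>1\<close> in \<open>Y\<^sub>V(v,x)\<close>;
  \<open>wtV V n\<close>, for \<open>n\<close> a half-integer, is the homogeneous subspace of weight \<open>n\<close>, and \<open>parV V s\<close>
  the subspace of fermion number \<open>s\<close>.
\<close>

record 'v vsa_data = "(complex, 'v) module" +
  wtV :: "real \<Rightarrow> 'v set"
  parV :: "bit \<Rightarrow> 'v set"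
  vacV :: 'v
  modeV :: "'v \<Rightarrow> int \<Rightarrow> 'v \<Rightarrow> 'v"
  L0V :: "'v \<Rightarrow> 'v"
  Lm1V :: "'v \<Rightarrow> 'v"

definition half_ints :: "real set"
  where "half_ints = {n. 2 * n \<in> \<int>}"

text \<open>
  Formal differentiation of \<open>\<Sum>\<^sub>n c\<^sub>n x\<^sup>-\<^sup>n\<^sup>-\<^sup>1\<close>; the coefficient of \<open>x\<^sup>-\<^sup>n\<^sup>-\<^sup>1\<close>
  in \<open>x d/dx\<close> of that series is \<open>ddxV V c (n + 1)\<close>.
\<close>

definition ddxV :: "'v vsa_data \<Rightarrow> (int \<Rightarrow> 'v) \<Rightarrow> int \<Rightarrow> 'v"
  where "ddxV V c n = (- of_int n) \<odot>\<^bsub>V\<^esub> c (n - 1)"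

locale grading_restricted_vertex_superalgebra =
  fixes V :: "'v vsa_data" (structure)
  assumes space: "complex_space V"
    and weight_grading: "direct_sum_on V (carrier V) half_ints (wtV V)"
    and fermion_grading: "direct_sum_on V (carrier V) UNIV (parV V)"
    and bigrading:
      "direct_sum_on V (carrier V) (half_ints \<times> UNIV) (\<lambda>(n, s). wtV V n \<inter> parV V s)"
    and finite_dim:
      "\<And>n. n \<in> half_ints \<Longrightarrow> \<exists>S. finite S \<and> S \<subseteq> wtV V n \<and> linspan V S = wtV V n"
    and lower_bound: "\<exists>N. \<forall>n\<in>half_ints. n < N \<longrightarrow> wtV V n = {\<zero>}"
    and mode_linear_right: "\<And>v n. v \<in> carrier V \<Longrightarrow> linear_op V (modeV V v n)"
    and mode_add_left: "\<And>u v n w. \<lbrakk>u \<in> carrier V; v \<in> carrier V; w \<in> carrier V\<rbrakk> \<Longrightarrow>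
      modeV V (u \<oplus> v) n w = modeV V u n w \<oplus> modeV V v n w"
    and mode_smult_left: "\<And>c v n w. \<lbrakk>v \<in> carrier V; w \<in> carrier V\<rbrakk> \<Longrightarrow>
      modeV V (c \<odot> v) n w = c \<odot> modeV V v n w"
    and truncation: "\<And>u v. \<lbrakk>u \<in> carrier V; v \<in> carrier V\<rbrakk> \<Longrightarrow>
      \<exists>N. \<forall>n\<ge>N. modeV V u n v = \<zero>"
    and mode_even: "\<And>s t u v n. \<lbrakk>u \<in> parV V s; v \<in> parV V t\<rbrakk> \<Longrightarrow> modeV V u n v \<in> parV V (s + t)"
    and L0_linear: "linear_op V (L0V V)"
    and L0_weight: "\<And>n v. \<lbrakk>n \<in> half_ints; v \<in> wtV V n\<rbrakk> \<Longrightarrow> L0V V v = complex_of_real n \<odot> v"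
    and Lm1_linear: "linear_op V (Lm1V V)"
    and vacuum_homogeneous: "vacV V \<in> wtV V 0 \<inter> parV V 0"
    and vacuum: "\<And>v n. v \<in> carrier V \<Longrightarrow> modeV V (vacV V) n v = (if n = -1 then v else \<zero>)"
    and creation: "\<And>v n. \<lbrakk>v \<in> carrier V; n \<ge> 0\<rbrakk> \<Longrightarrow> modeV V v n (vacV V) = \<zero>"
      "\<And>v. v \<in> carrier V \<Longrightarrow> modeV V v (-1) (vacV V) = v"
    \<comment> \<open>The coefficient of \<open>x\<^sub>0\<^sup>-\<^sup>l\<^sup>-\<^sup>1 x\<^sub>1\<^sup>-\<^sup>m\<^sup>-\<^sup>1 x\<^sub>2\<^sup>-\<^sup>n\<^sup>-\<^sup>1\<close> of the super Jacobi identity. Each sum is finite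
      by truncation.\<close>
    and jacobi: "\<And>s t u v w l m n. \<lbrakk>u \<in> parV V s; v \<in> parV V t; w \<in> carrier V\<rbrakk> \<Longrightarrow>
      fin_supp_sum V (\<lambda>i. (((of_int l) gchoose i) * (- 1) ^ i) \<odot>
          modeV V u (l + m - int i) (modeV V v (n + int i) w)) UNIV
      \<ominus> super_sign s t \<odot>
        fin_supp_sum V (\<lambda>i. (((of_int l) gchoose i) * (- 1) powi (l - int i)) \<odot>
          modeV V v (l + n - int i) (modeV V u (m + int i) w)) UNIV
      = fin_supp_sum V (\<lambda>i. ((of_int m) gchoose i) \<odot>
          modeV V (modeV V u (l + int i) v) (m + n - int i) w) UNIV"
    and L0_commutator: "\<And>v w n. \<lbrakk>v \<in> carrier V; w \<in> carrier V\<rbrakk> \<Longrightarrow>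
      L0V V (modeV V v n w) \<ominus> modeV V v n (L0V V w)
      = ddxV V (\<lambda>j. modeV V v j w) (n + 1) \<oplus> modeV V (L0V V v) n w"
    and Lm1_derivative: "\<And>v w n. \<lbrakk>v \<in> carrier V; w \<in> carrier V\<rbrakk> \<Longrightarrow>
      ddxV V (\<lambda>j. modeV V v j w) n = modeV V (Lm1V V v) n w"
    and Lm1_commutator: "\<And>v w n. \<lbrakk>v \<in> carrier V; w \<in> carrier V\<rbrakk> \<Longrightarrow>
      ddxV V (\<lambda>j. modeV V v j w) n = Lm1V V (modeV V v n w) \<ominus> modeV V v n (Lm1V V w)"

text \<open>
  Since the weight spaces are finite-dimensional and preserved by \<open>g\<close>, the decomposition of
  \<open>V\<close> into generalized eigenspaces of \<open>g\<close> and the operators \<open>L\<^sub>g\<close>, \<open>S\<^sub>g\<close>, \<open>N\<^sub>g\<close> on \<open>V\<close> exist for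
  every automorphism \<open>g\<close>.
\<close>

definition vsa_automorphism :: "'v vsa_data \<Rightarrow> ('v \<Rightarrow> 'v) \<Rightarrow> bool"
  where "vsa_automorphism V g \<longleftrightarrow>
    linear_op V g \<and> bij_betw g (carrier V) (carrier V) \<and>
    (\<forall>n\<in>half_ints. g ` wtV V n \<subseteq> wtV V n) \<and> (\<forall>s. g ` parV V s \<subseteq> parV V s) \<and>
    g (vacV V) = vacV V \<and>
    (\<forall>u\<in>carrier V. \<forall>v\<in>carrier V. \<forall>n. g (modeV V u n v) = modeV V (g u) n (g v)) \<and>
    (\<forall>v\<in>carrier V. g (Lm1V V v) = Lm1V V (g v))"


section \<open>Lower-bounded generalized twisted modules\<close>

text \<open>
  \<open>modeW W v n k\<close> is the coefficient of \<open>x\<^sup>-\<^sup>n\<^sup>-\<^sup>1 (log x)\<^sup>k\<close> in the twisted vertex operator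
  of \<open>v\<close>, and \<open>gW\<close> is the action of \<open>g\<close>. The weight and \<open>g\<close>-weight spaces are not part of the
  data, as they are determined by \<open>L0W\<close> and \<open>gW\<close>.
\<close>

record ('v, 'w) twisted_data = "(complex, 'w) module" +
  parW :: "bit \<Rightarrow> 'w set"
  gW :: "'w \<Rightarrow> 'w"
  L0W :: "'w \<Rightarrow> 'w"
  Lm1W :: "'w \<Rightarrow> 'w"
  modeW :: "'v \<Rightarrow> complex \<Rightarrow> nat \<Rightarrow> 'w \<Rightarrow> 'w"

definition wt_space :: "('v, 'w) twisted_data \<Rightarrow> complex \<Rightarrow> 'w set"
  where "wt_space W n = gen_eigenspace W (L0W W) n"

definition gwt_space :: "('v, 'w) twisted_data \<Rightarrow> complex \<Rightarrow> 'w set"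
  where "gwt_space W \<alpha> = gen_eigenspace W (gW W) (exp (2 * of_real pi * \<i> * \<alpha>))"

text \<open>A class in \<open>\<complex>/\<int>\<close> is represented by its unique element \<open>\<alpha>\<close> with \<open>0 \<le> Re \<alpha> < 1\<close>.\<close>

definition hom_index :: "(complex \<times> bit \<times> complex) set"
  where "hom_index = UNIV \<times> UNIV \<times> {\<alpha>. 0 \<le> Re \<alpha> \<and> Re \<alpha> < 1}"

definition hom_space :: "('v, 'w) twisted_data \<Rightarrow> complex \<times> bit \<times> complex \<Rightarrow> 'w set"
  where "hom_space W = (\<lambda>(n, s, \<alpha>). wt_space W n \<inter> parW W s \<inter> gwt_space W \<alpha>)"

definition graded_dual :: "('v, 'w) twisted_data \<Rightarrow> ('w \<Rightarrow> complex) set"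
  where "graded_dual W = {\<phi>. linear_functional W \<phi> \<and>
    finite {i \<in> hom_index. \<exists>x\<in>hom_space W i. \<phi> x \<noteq> 0}}"

text \<open>
  The action of \<open>g\<close> on \<open>W\<close> is \<open>exp (2\<pi>i(S + N))\<close>, where \<open>S\<close> is multiplication by \<open>\<alpha>\<close> on
  the \<open>g\<close>-weight space of \<open>\<alpha>\<close> and \<open>N\<close> preserves these spaces and is locally nilpotent.
\<close>

definition exp_form :: "('v, 'w) twisted_data \<Rightarrow> bool"
  where "exp_form W \<longleftrightarrow> (\<exists>N. linear_op W N \<and>
    (\<forall>x\<in>carrier W. \<exists>k. (N ^^ k) x = \<zero>\<^bsub>W\<^esub>) \<and>
    (\<forall>\<alpha>. 0 \<le> Re \<alpha> \<and> Re \<alpha> < 1 \<longrightarrow> (\<forall>x\<in>gwt_space W \<alpha>.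
      N x \<in> gwt_space W \<alpha> \<and>
      gW W x = exp (2 * of_real pi * \<i> * \<alpha>) \<odot>\<^bsub>W\<^esub>
        fin_supp_sum W (\<lambda>k. ((2 * of_real pi * \<i>) ^ k / fact k) \<odot>\<^bsub>W\<^esub> (N ^^ k) x) UNIV)))"

text \<open>
  Formal differentiation of \<open>\<Sum>\<^sub>n\<^sub>,\<^sub>k c\<^sub>n\<^sub>,\<^sub>k x\<^sup>-\<^sup>n\<^sup>-\<^sup>1 (log x)\<^sup>k\<close>; the coefficient of
  \<open>x\<^sup>-\<^sup>n\<^sup>-\<^sup>1 (log x)\<^sup>k\<close> in \<open>x d/dx\<close> of that series is \<open>ddxW W c (n + 1) k\<close>.
\<close>

definition ddxW ::
    "('v, 'w) twisted_data \<Rightarrow> (complex \<Rightarrow> nat \<Rightarrow> 'w) \<Rightarrow> complex \<Rightarrow> nat \<Rightarrow> 'w"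
  where "ddxW W c n k = (- n) \<odot>\<^bsub>W\<^esub> c (n - 1) k \<oplus>\<^bsub>W\<^esub> of_nat (k + 1) \<odot>\<^bsub>W\<^esub> c (n - 1) (k + 1)"

definition log_branch :: "int \<Rightarrow> complex \<Rightarrow> complex"
  where "log_branch p z =
    of_real (ln (cmod z)) + \<i> * of_real (Arg2pi z) + 2 * of_real pi * \<i> * of_int p"

text \<open>The value of \<open>x\<^sup>-\<^sup>n\<^sup>-\<^sup>1 (log x)\<^sup>k\<close> under \<open>log x \<mapsto> l\<^sub>p(z)\<close>\<close>

definition mono_val :: "int \<Rightarrow> complex \<Rightarrow> complex \<Rightarrow> nat \<Rightarrow> complex"
  where "mono_val p z n k = exp ((- n - 1) * log_branch p z) * log_branch p z ^ k"

definition abs_sums_to :: "('i \<Rightarrow> complex) \<Rightarrow> complex \<Rightarrow> bool"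
  where "abs_sums_to h c \<longleftrightarrow> (\<lambda>i. norm (h i)) summable_on UNIV \<and> (h has_sum c) UNIV"

text \<open>
  The terms of the multiple series
  \<open>\<langle>\<phi>, Y\<^sup>p(v,z) w\<rangle>\<close>, \<open>\<langle>\<phi>, Y\<^sup>p(u,z\<^sub>1) Y\<^sup>p(v,z\<^sub>2) w\<rangle>\<close> and \<open>\<langle>\<phi>, Y\<^sup>p(Y\<^sub>V(u,z\<^sub>1-z\<^sub>2) v, z\<^sub>2) w\<rangle>\<close>.
\<close>

definition one_term :: "('v, 'w) twisted_data \<Rightarrow> int \<Rightarrow> ('w \<Rightarrow> complex) \<Rightarrow> 'v \<Rightarrow> complex \<Rightarrow> 'w \<Rightarrow>
    complex \<times> nat \<Rightarrow> complex"
  where "one_term W p \<phi> v z w = (\<lambda>(n, k). \<phi> (modeW W v n k w) * mono_val p z n k)"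

definition product_term :: "('v, 'w) twisted_data \<Rightarrow> int \<Rightarrow> ('w \<Rightarrow> complex) \<Rightarrow>
    'v \<Rightarrow> complex \<Rightarrow> 'v \<Rightarrow> complex \<Rightarrow> 'w \<Rightarrow> (complex \<times> nat) \<times> (complex \<times> nat) \<Rightarrow> complex"
  where "product_term W p \<phi> u z1 v z2 w = (\<lambda>((m, k), (n, l)).
    \<phi> (modeW W u m k (modeW W v n l w)) * mono_val p z1 m k * mono_val p z2 n l)"

definition iterate_term :: "'v vsa_data \<Rightarrow> ('v, 'w) twisted_data \<Rightarrow> int \<Rightarrow> ('w \<Rightarrow> complex) \<Rightarrow>
    'v \<Rightarrow> complex \<Rightarrow> 'v \<Rightarrow> complex \<Rightarrow> 'w \<Rightarrow> int \<times> (complex \<times> nat) \<Rightarrow> complex"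
  where "iterate_term V W p \<phi> u z1 v z2 w = (\<lambda>(j, (n, k)).
    \<phi> (modeW W (modeV V u j v) n k w) * (z1 - z2) powi (- j - 1) * mono_val p z2 n k)"

text \<open>
  The branch \<open>log z\<^sub>j = l\<^sub>p(z\<^sub>j)\<close> of
  \<open>\<Sum> a(m,n,k,l) z\<^sub>1\<^sup>m z\<^sub>2\<^sup>n (log z\<^sub>1)\<^sup>k (log z\<^sub>2)\<^sup>l (z\<^sub>1-z\<^sub>2)\<^sup>-\<^sup>t\<close>, the sum being over the finite set \<open>F\<close>
\<close>

definition corr_branch :: "(complex \<times> complex \<times> nat \<times> nat) set \<Rightarrow>
    (complex \<times> complex \<times> nat \<times> nat \<Rightarrow> complex) \<Rightarrow> nat \<Rightarrow> int \<Rightarrow> complex \<Rightarrow> complex \<Rightarrow> complex"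
  where "corr_branch F a t p z1 z2 =
    (\<Sum>(m, n, k, l)\<in>F. a (m, n, k, l) * exp (m * log_branch p z1) * exp (n * log_branch p z2)
        * log_branch p z1 ^ k * log_branch p z2 ^ l / (z1 - z2) ^ t)"

locale lower_bounded_twisted_module =
  fixes V :: "'v vsa_data" and g :: "'v \<Rightarrow> 'v" and W :: "('v, 'w) twisted_data"
  assumes vsa: "grading_restricted_vertex_superalgebra V"
    and automorphism: "vsa_automorphism V g"
    and space: "complex_space W"
    and fermion_grading: "direct_sum_on W (carrier W) UNIV (parW W)"
    and grading: "direct_sum_on W (carrier W) hom_index (hom_space W)"
    and lower_bound: "\<exists>B. \<forall>n. Re n < B \<longrightarrow> wt_space W n = {\<zero>\<^bsub>W\<^esub>}"
    and g_linear: "linear_op W (gW W)"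
    and g_bij: "bij_betw (gW W) (carrier W) (carrier W)"
    and g_exp: "exp_form W"
    and L0_linear: "linear_op W (L0W W)"
    and Lm1_linear: "linear_op W (Lm1W W)"
    and L0_Lm1: "\<And>w. w \<in> carrier W \<Longrightarrow>
      L0W W (Lm1W W w) \<ominus>\<^bsub>W\<^esub> Lm1W W (L0W W w) = Lm1W W w"
    and mode_linear_right: "\<And>v n k. v \<in> carrier V \<Longrightarrow> linear_op W (modeW W v n k)"
    and mode_add_left: "\<And>u v n k w. \<lbrakk>u \<in> carrier V; v \<in> carrier V; w \<in> carrier W\<rbrakk> \<Longrightarrow>
      modeW W (u \<oplus>\<^bsub>V\<^esub> v) n k w = modeW W u n k w \<oplus>\<^bsub>W\<^esub> modeW W v n k w"
    and mode_smult_left: "\<And>c v n k w. \<lbrakk>v \<in> carrier V; w \<in> carrier W\<rbrakk> \<Longrightarrow>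
      modeW W (c \<odot>\<^bsub>V\<^esub> v) n k w = c \<odot>\<^bsub>W\<^esub> modeW W v n k w"
    and log_polynomial: "\<And>v w. \<lbrakk>v \<in> carrier V; w \<in> carrier W\<rbrakk> \<Longrightarrow>
      \<exists>K. \<forall>k>K. \<forall>n. modeW W v n k w = \<zero>\<^bsub>W\<^esub>"
    and mode_even: "\<And>s t v w n k. \<lbrakk>v \<in> parV V s; w \<in> parW W t\<rbrakk> \<Longrightarrow>
      modeW W v n k w \<in> parW W (s + t)"
    and identity: "\<And>w n k. w \<in> carrier W \<Longrightarrow>
      modeW W (vacV V) n k w = (if n = -1 \<and> k = 0 then w else \<zero>\<^bsub>W\<^esub>)"
    and g_compat: "\<And>v w n k. \<lbrakk>v \<in> carrier V; w \<in> carrier W\<rbrakk> \<Longrightarrow>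
      gW W (modeW W v n k w) = modeW W (g v) n k (gW W w)"
    and L0_commutator: "\<And>v w n k. \<lbrakk>v \<in> carrier V; w \<in> carrier W\<rbrakk> \<Longrightarrow>
      L0W W (modeW W v n k w) \<ominus>\<^bsub>W\<^esub> modeW W v n k (L0W W w)
      = ddxW W (\<lambda>n k. modeW W v n k w) (n + 1) k \<oplus>\<^bsub>W\<^esub> modeW W (L0V V v) n k w"
    and Lm1_derivative: "\<And>v w n k. \<lbrakk>v \<in> carrier V; w \<in> carrier W\<rbrakk> \<Longrightarrow>
      ddxW W (\<lambda>n k. modeW W v n k w) n k = modeW W (Lm1V V v) n k w"
    and Lm1_commutator: "\<And>v w n k. \<lbrakk>v \<in> carrier V; w \<in> carrier W\<rbrakk> \<Longrightarrow>
      ddxW W (\<lambda>n k. modeW W v n k w) n k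
      = Lm1W W (modeW W v n k w) \<ominus>\<^bsub>W\<^esub> modeW W v n k (Lm1W W w)"
    \<comment> \<open>An identity in the algebraic completion of \<open>W\<close>, on which the graded dual separates
      points; only finitely many terms of either series are nonzero.\<close>
    and equivariance: "\<And>p \<phi> v z w. \<lbrakk>\<phi> \<in> graded_dual W; v \<in> carrier V; w \<in> carrier W; z \<noteq> 0\<rbrakk> \<Longrightarrow>
      (\<Sum>\<^sub>\<infinity>i. one_term W (p + 1) \<phi> (g v) z w i) = (\<Sum>\<^sub>\<infinity>i. one_term W p \<phi> v z w i)"
    and duality: "\<And>s t u v w \<phi>.
      \<lbrakk>u \<in> parV V s; v \<in> parV V t; w \<in> carrier W; \<phi> \<in> graded_dual W\<rbrakk> \<Longrightarrow>
      \<exists>F a T. finite F \<and> (\<forall>p z1 z2.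
        (cmod z1 > cmod z2 \<and> cmod z2 > 0 \<longrightarrow>
          abs_sums_to (product_term W p \<phi> u z1 v z2 w) (corr_branch F a T p z1 z2)) \<and>
        (cmod z2 > cmod z1 \<and> cmod z1 > 0 \<longrightarrow>
          abs_sums_to (\<lambda>i. super_sign s t * product_term W p \<phi> v z2 u z1 w i)
            (corr_branch F a T p z1 z2)) \<and>
        (cmod z2 > cmod (z1 - z2) \<and> cmod (z1 - z2) > 0 \<longrightarrow>
          (\<exists>c. abs_sums_to (iterate_term V W p \<phi> u z1 v z2 w) c) \<and>
          (\<bar>Arg2pi z1 - Arg2pi z2\<bar> < pi / 2 \<longrightarrow>
            abs_sums_to (iterate_term V W p \<phi> u z1 v z2 w) (corr_branch F a T p z1 z2))))"


section \<open>Submodules, quotients and irreducibility\<close>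

definition twisted_submodule :: "'v vsa_data \<Rightarrow> ('v, 'w) twisted_data \<Rightarrow> 'w set \<Rightarrow> bool"
  where "twisted_submodule V W J \<longleftrightarrow>
    subspace_of J W \<and>
    direct_sum_on W J hom_index (\<lambda>i. J \<inter> hom_space W i) \<and>
    (\<forall>v\<in>carrier V. \<forall>n k. \<forall>x\<in>J. modeW W v n k x \<in> J) \<and>
    (\<forall>x\<in>J. L0W W x \<in> J \<and> Lm1W W x \<in> J \<and> gW W x \<in> J)"

definition maximal_submodule :: "'v vsa_data \<Rightarrow> ('v, 'w) twisted_data \<Rightarrow> 'w set \<Rightarrow> bool"
  where "maximal_submodule V W J \<longleftrightarrow>
    twisted_submodule V W J \<and> J \<noteq> carrier W \<and>
    (\<forall>K. twisted_submodule V W K \<and> J \<subseteq> K \<longrightarrow> K = J \<or> K = carrier W)"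

text \<open>
  The map on cosets induced by \<open>f\<close>. If \<open>f\<close> is linear and leaves the subspace \<open>J\<close> invariant, it sends
  the coset of \<open>x\<close> to the coset of \<open>f x\<close>.
\<close>

definition induced :: "('v, 'w) twisted_data \<Rightarrow> 'w set \<Rightarrow> ('w \<Rightarrow> 'w) \<Rightarrow> 'w set \<Rightarrow> 'w set"
  where "induced W J f K = (\<Union>x\<in>K. J +>\<^bsub>W\<^esub> f x)"

definition quotient_data ::
    "('v, 'w) twisted_data \<Rightarrow> 'w set \<Rightarrow> ('v, 'w set) twisted_data"
  where "quotient_data W J =
    \<lparr> carrier = a_rcosets\<^bsub>W\<^esub> J,
      mult = (\<lambda>K L. J), one = J, \<comment> \<open>irrelevant\<close>
      zero = J,
      add = set_add W,
      smult = (\<lambda>c. induced W J (smult W c)),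
      parW = (\<lambda>s. (\<lambda>x. J +>\<^bsub>W\<^esub> x) ` parW W s),
      gW = induced W J (gW W),
      L0W = induced W J (L0W W),
      Lm1W = induced W J (Lm1W W),
      modeW = (\<lambda>v n k. induced W J (modeW W v n k)) \<rparr>"

definition irreducible_twisted_module ::
    "'v vsa_data \<Rightarrow> ('v \<Rightarrow> 'v) \<Rightarrow> ('v, 'w) twisted_data \<Rightarrow> bool"
  where "irreducible_twisted_module V g W \<longleftrightarrow>
    lower_bounded_twisted_module V g W \<and>
    carrier W \<noteq> {\<zero>\<^bsub>W\<^esub>} \<and>
    (\<forall>J. twisted_submodule V W J \<longrightarrow> J = {\<zero>\<^bsub>W\<^esub>} \<or> J = carrier W)"

definition generated_by :: "'v vsa_data \<Rightarrow> ('v, 'w) twisted_data \<Rightarrow> 'w set \<Rightarrow> bool"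
  where "generated_by V W S \<longleftrightarrow>
    carrier W = linspan W {modeW W v n k ((Lm1W W ^^ p) ((L0W W ^^ q) w)) | v n k p q w.
      v \<in> carrier V \<and> w \<in> S}"

end

(*
  Among the submodules avoiding w, Zorn's lemma gives a maximal one J. A submodule properly
  containing J contains w, hence is all of W, so J is maximal and the preimage argument shows
  that W/J has no proper nonzero submodules.

  That W/J is again a lower-bounded twisted module needs care, because its homogeneous subspaces
  are defined by the operators induced by L(0) and g. Generalized eigenspaces for different
  eigenvalues are independent, so a homogeneous element of W/J has no components other than
  the one of its own degree; hence the homogeneous subspaces of W/J are the images of those of W.
  The same argument with eigenvalue 0 shows that g is injective on W/J. The nilpotent part N of
  log g preserves J because exp N does.
*)

theory Submission
  imports Defs
begin

section \<open>Complex vector spaces\<close>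

text \<open>The sum of all submodules avoiding \<open>w\<close> cannot serve as J, since that sum
  may contain \<open>w\<close>: if W is the direct sum of two irreducible modules generated by
  eigenvectors w1, w2 of L(0) with different eigenvalues and w = w1 + w2, both summands avoid
  \<open>w\<close>. Hence Zorn's lemma, and no uniqueness of J. Weight and g-weight spaces are read
  off from the operators, so those of the quotient might a priori be larger than the images of those
  of W: a class could be killed by a power of L(0) - n although no representative is. The quotient
  is therefore first graded by the images, and only then are its intrinsic subspaces compared with
  them. A submodule is by definition graded and stable under g, but neither under the inverse of g
  nor under N. Injectivity of g on the quotient and stability of J under N have to be extracted from
  the grading.\<close>

lemma complex_ring_simps [simp]:
  "carrier complex_ring = UNIV" "x \<oplus>\<^bsub>complex_ring\<^esub> y = x + y" "x \<otimes>\<^bsub>complex_ring\<^esub> y = x * y"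
  "\<one>\<^bsub>complex_ring\<^esub> = 1" "\<zero>\<^bsub>complex_ring\<^esub> = 0"
  by (simp_all add: ring_of_type_algebra_def)

locale complex_vs =
  fixes M :: "(complex, 'a, 'm) module_scheme" (structure)
  assumes complex_space: "complex_space M"

sublocale complex_vs \<subseteq> module complex_ring M
  by (rule complex_space)

context complex_vs
begin

lemma smult_carrier [simp, intro]: "x \<in> carrier M \<Longrightarrow> c \<odot> x \<in> carrier M"
  by (rule smult_closed) auto

lemma smult_add_left: "x \<in> carrier M \<Longrightarrow> (a + b) \<odot> x = a \<odot> x \<oplus> b \<odot> x"
  using smult_l_distr[of a b x] by simp

lemma smult_add_right:
  "\<lbrakk>x \<in> carrier M; y \<in> carrier M\<rbrakk> \<Longrightarrow> a \<odot> (x \<oplus> y) = a \<odot> x \<oplus> a \<odot> y"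
  using smult_r_distr[of a x y] by simp

lemma smult_smult: "x \<in> carrier M \<Longrightarrow> a \<odot> (b \<odot> x) = (a * b) \<odot> x"
  using smult_assoc1[of a b x] by simp

lemma smult_1 [simp]: "x \<in> carrier M \<Longrightarrow> 1 \<odot> x = x"
  using smult_one[of x] by simp

lemma smult_0 [simp]: "x \<in> carrier M \<Longrightarrow> 0 \<odot> x = \<zero>"
  using smult_l_null[of x] by simp

lemma smult_zero [simp]: "c \<odot> \<zero> = \<zero>"
  using smult_r_null[of c] by simp

lemma neg_eq_smult: "x \<in> carrier M \<Longrightarrow> \<ominus> x = (- 1) \<odot> x"
  using smult_add_left[of x 1 "-1"] by (simp add: M.minus_equality M.a_comm)

lemma smult_neg: "x \<in> carrier M \<Longrightarrow> c \<odot> (\<ominus> x) = \<ominus> (c \<odot> x)"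
  by (simp add: neg_eq_smult smult_smult)

lemma smult_eq_zero_iff:
  assumes "x \<in> carrier M" "c \<noteq> 0"
  shows "c \<odot> x = \<zero> \<longleftrightarrow> x = \<zero>"
proof
  assume "c \<odot> x = \<zero>"
  then have "inverse c \<odot> (c \<odot> x) = \<zero>" by simp
  then show "x = \<zero>" using assms by (simp add: smult_smult)
qed simp

lemma diff_add_cancel: "\<lbrakk>x \<in> carrier M; y \<in> carrier M\<rbrakk> \<Longrightarrow> x \<ominus> y \<oplus> y = x"
  by (simp add: M.minus_eq M.a_assoc M.l_neg)

lemma add_diff_cancel: "\<lbrakk>x \<in> carrier M; y \<in> carrier M\<rbrakk> \<Longrightarrow> x \<oplus> y \<ominus> y = x"
  by (simp add: M.minus_eq M.a_assoc M.r_neg)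

lemma diff_eq_zero_iff: "\<lbrakk>x \<in> carrier M; y \<in> carrier M\<rbrakk> \<Longrightarrow> x \<ominus> y = \<zero> \<longleftrightarrow> x = y"
  using diff_add_cancel[of x y] by (auto simp: M.minus_eq M.r_neg)

text \<open>Zero is 0 times any member of a nonempty set and negation is multiplication by -1, so
  the subgroup conditions in \<open>submodule\<close> reduce to closure under sums and
  multiples.\<close>

lemma subspace_iff:
  "subspace_of H M \<longleftrightarrow> H \<subseteq> carrier M \<and> \<zero> \<in> H \<and> (\<forall>x\<in>H. \<forall>y\<in>H. x \<oplus> y \<in> H) \<and>
    (\<forall>c. \<forall>x\<in>H. c \<odot> x \<in> H)"
proof
  assume H: "subspace_of H M"
  then have "\<zero> \<in> H"
    using submoduleE(1,2)[OF H] submoduleE(4)[OF H, of 0] by force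
  then show "H \<subseteq> carrier M \<and> \<zero> \<in> H \<and> (\<forall>x\<in>H. \<forall>y\<in>H. x \<oplus> y \<in> H) \<and> (\<forall>c. \<forall>x\<in>H. c \<odot> x \<in> H)"
    using submoduleE[OF H] by auto
next
  assume "H \<subseteq> carrier M \<and> \<zero> \<in> H \<and> (\<forall>x\<in>H. \<forall>y\<in>H. x \<oplus> y \<in> H) \<and> (\<forall>c. \<forall>x\<in>H. c \<odot> x \<in> H)"
  then show "subspace_of H M"
    by (intro submoduleI) (auto simp: neg_eq_smult subset_iff)
qed

lemma subspace_carrier: "subspace_of H M \<Longrightarrow> x \<in> H \<Longrightarrow> x \<in> carrier M"
  and subspace_zero: "subspace_of H M \<Longrightarrow> \<zero> \<in> H"
  and subspace_add: "subspace_of H M \<Longrightarrow> x \<in> H \<Longrightarrow> y \<in> H \<Longrightarrow> x \<oplus> y \<in> H"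
  and subspace_smult: "subspace_of H M \<Longrightarrow> x \<in> H \<Longrightarrow> c \<odot> x \<in> H"
  by (auto simp: subspace_iff)

lemma subspace_diff: "subspace_of H M \<Longrightarrow> x \<in> H \<Longrightarrow> y \<in> H \<Longrightarrow> x \<ominus> y \<in> H"
  by (simp add: M.minus_eq submoduleE(3) subspace_add)

lemma subspace_Int: "subspace_of H M \<Longrightarrow> subspace_of K M \<Longrightarrow> subspace_of (H \<inter> K) M"
  by (auto simp: subspace_iff)

lemma subspace_finsum:
  assumes "subspace_of H M" "\<And>i. i \<in> F \<Longrightarrow> f i \<in> H"
  shows "finsum M f F \<in> H"
  using assms(2)
proof (induction F rule: infinite_finite_induct)
  case (insert i F)
  then show ?case
    using assms(1) by (simp add: Pi_def subspace_carrier subspace_add)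
qed (use assms(1) in \<open>simp_all add: subspace_zero\<close>)

lemma finsum_zeros: "(\<And>i. i \<in> F \<Longrightarrow> f i = \<zero>) \<Longrightarrow> finsum M f F = \<zero>"
  by (rule M.add.finprod_one_eqI)

text \<open>Frees the sum from the exact support: two vectors can be expanded over the union of
  their supports, and a map may kill some of the terms.\<close>

lemma fin_supp_sum_eq_finsum:
  assumes "finite F" "F \<subseteq> I" "\<And>i. i \<in> I - F \<Longrightarrow> f i = \<zero>" "\<And>i. i \<in> F \<Longrightarrow> f i \<in> carrier M"
  shows "fin_supp_sum M f I = finsum M f F"
  unfolding fin_supp_sum_def
  by (rule M.add.finprod_mono_neutral_cong_left) (use assms in auto)

lemma finsum_diff:
  assumes "finite F" "f \<in> F \<rightarrow> carrier M" "h \<in> F \<rightarrow> carrier M"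
  shows "(\<Oplus>i\<in>F. f i \<ominus> h i) = finsum M f F \<ominus> finsum M h F"
proof -
  have "(\<Oplus>i\<in>F. f i \<ominus> h i) \<oplus> finsum M h F = (\<Oplus>i\<in>F. (f i \<ominus> h i) \<oplus> h i)"
    using assms by (intro M.finsum_addf [symmetric]) auto
  also have "\<dots> = finsum M f F"
    using assms by (intro M.finsum_cong') (auto simp: M.minus_eq M.a_assoc M.l_neg Pi_def)
  finally show ?thesis
    using assms add_diff_cancel[of "\<Oplus>i\<in>F. f i \<ominus> h i" "finsum M h F"] by (auto simp: Pi_def)
qed

text \<open>In \<open>pr_eq_zero\<close> the fibres of \<open>e\<close> collect the components of
  equal weight, parity or eigenvalue of g.\<close>

lemma finsum_group:
  assumes "finite F" "finite E" "e ` F \<subseteq> E" "f \<in> F \<rightarrow> carrier M"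
  shows "(\<Oplus>c\<in>E. finsum M f {i \<in> F. e i = c}) = finsum M f F"
proof -
  have "finsum M f (\<Union>c\<in>E. {i \<in> F. e i = c}) = (\<Oplus>c\<in>E. finsum M f {i \<in> F. e i = c})"
    by (rule M.add.finprod_UN_disjoint) (use assms in \<open>auto simp: pairwise_def disjnt_def\<close>)
  moreover have "(\<Union>c\<in>E. {i \<in> F. e i = c}) = F" using assms(3) by auto
  ultimately show ?thesis by simp
qed

lemma finsum_delta:
  assumes "finite F" "c \<in> F" "x \<in> carrier M"
  shows "(\<Oplus>i\<in>F. if i = c then x else \<zero>) = x"
proof -
  have "(\<Oplus>i\<in>F. if i = c then x else \<zero>) = finsum M (\<lambda>i. x) {c}"
    by (rule M.add.finprod_mono_neutral_cong_right) (use assms in auto)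
  then show ?thesis using assms by simp
qed

end

section \<open>Linear maps between two spaces\<close>

locale complex_linear = A: complex_vs A + B: complex_vs B
  for A :: "(complex, 'a, 'm) module_scheme" and B :: "(complex, 'b, 'n) module_scheme" +
  fixes h :: "'a \<Rightarrow> 'b"
  assumes closed [simp, intro]: "x \<in> carrier A \<Longrightarrow> h x \<in> carrier B"
    and add: "\<lbrakk>x \<in> carrier A; y \<in> carrier A\<rbrakk> \<Longrightarrow> h (x \<oplus>\<^bsub>A\<^esub> y) = h x \<oplus>\<^bsub>B\<^esub> h y"
    and smult: "x \<in> carrier A \<Longrightarrow> h (c \<odot>\<^bsub>A\<^esub> x) = c \<odot>\<^bsub>B\<^esub> h x"
begin

lemma zero [simp]: "h \<zero>\<^bsub>A\<^esub> = \<zero>\<^bsub>B\<^esub>"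
  using smult[of "\<zero>\<^bsub>A\<^esub>" 0] by simp

lemma neg: "x \<in> carrier A \<Longrightarrow> h (\<ominus>\<^bsub>A\<^esub> x) = \<ominus>\<^bsub>B\<^esub> h x"
  by (simp add: A.neg_eq_smult B.neg_eq_smult smult)

lemma diff: "\<lbrakk>x \<in> carrier A; y \<in> carrier A\<rbrakk> \<Longrightarrow> h (x \<ominus>\<^bsub>A\<^esub> y) = h x \<ominus>\<^bsub>B\<^esub> h y"
  by (simp add: a_minus_def add neg)

lemma finsum:
  assumes "f \<in> F \<rightarrow> carrier A"
  shows "h (finsum A f F) = finsum B (\<lambda>i. h (f i)) F"
  using assms
proof (induction F rule: infinite_finite_induct)
  case (insert i F)
  then show ?case by (simp add: Pi_def add)
qed auto

lemma subspace_image: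
  assumes "subspace_of H A"
  shows "subspace_of (h ` H) B"
  unfolding B.subspace_iff
proof (intro conjI ballI allI)
  have [simp]: "x \<in> H \<Longrightarrow> x \<in> carrier A" for x by (rule A.subspace_carrier[OF assms])
  show "h ` H \<subseteq> carrier B" by auto
  show "\<zero>\<^bsub>B\<^esub> \<in> h ` H" using A.subspace_zero[OF assms] zero by (metis imageI)
  fix x y assume "x \<in> h ` H" "y \<in> h ` H"
  then show "x \<oplus>\<^bsub>B\<^esub> y \<in> h ` H"
    using A.subspace_add[OF assms] by (force simp: add [symmetric])
next
  fix c x assume "x \<in> h ` H"
  then show "c \<odot>\<^bsub>B\<^esub> x \<in> h ` H"
    using A.subspace_smult[OF assms] A.subspace_carrier[OF assms] by (force simp: smult [symmetric])
qed

end

context complex_vs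
begin

lemma linear_op_iff: "linear_op M T \<longleftrightarrow> complex_linear M M T"
  by (auto simp: linear_op_def complex_linear_def complex_linear_axioms_def complex_vs_axioms)

lemma linear_op_diff_smult:
  assumes "linear_op M T"
  shows "linear_op M (\<lambda>y. T y \<ominus> c \<odot> y)"
proof -
  interpret T: complex_linear M M T using assms by (simp add: linear_op_iff)
  show ?thesis
    unfolding linear_op_def
  proof (intro conjI ballI allI)
    fix x y assume [simp]: "x \<in> carrier M" "y \<in> carrier M"
    show "T x \<ominus> c \<odot> x \<in> carrier M" by simp
    show "T (x \<oplus> y) \<ominus> c \<odot> (x \<oplus> y) = T x \<ominus> c \<odot> x \<oplus> (T y \<ominus> c \<odot> y)"
      by (simp add: T.add smult_add_right M.minus_eq M.minus_add M.a_ac)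
  next
    fix d x assume [simp]: "x \<in> carrier M"
    show "T (d \<odot> x) \<ominus> c \<odot> (d \<odot> x) = d \<odot> (T x \<ominus> c \<odot> x)"
      by (simp add: T.smult smult_add_right M.minus_eq smult_smult smult_neg mult.commute)
  qed
qed

lemma linear_op_funpow: "linear_op M T \<Longrightarrow> linear_op M (T ^^ k)"
  by (induction k) (auto simp: linear_op_def)

lemma linear_op_carrier: "linear_op M T \<Longrightarrow> x \<in> carrier M \<Longrightarrow> T x \<in> carrier M"
  by (simp add: linear_op_def)

lemma linear_op_zero: "linear_op M T \<Longrightarrow> T \<zero> = \<zero>"
  by (simp add: linear_op_iff complex_linear.zero)

lemma funpow_zero_mono:
  assumes "linear_op M T" "(T ^^ k) x = \<zero>" "k \<le> l"
  shows "(T ^^ l) x = \<zero>"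
proof -
  have "(T ^^ l) x = (T ^^ (l - k)) ((T ^^ k) x)"
    using assms(3) funpow_add[of "l - k" k T] by simp
  then show ?thesis using assms(2) linear_op_zero[OF linear_op_funpow[OF assms(1)]] by simp
qed

section \<open>Generalized eigenspaces and nilpotent operators\<close>

lemma gen_eigenspace_subspace:
  assumes "linear_op M T"
  shows "subspace_of (gen_eigenspace M T c) M"
proof -
  define D where "D = (\<lambda>y. T y \<ominus> c \<odot> y)"
  have D: "linear_op M D" unfolding D_def by (rule linear_op_diff_smult[OF assms])
  have Dk: "complex_linear M M (D ^^ k)" for k
    using linear_op_funpow[OF D] by (simp add: linear_op_iff)
  have E: "gen_eigenspace M T c = {x \<in> carrier M. \<exists>k. (D ^^ k) x = \<zero>}"
    by (simp add: gen_eigenspace_def D_def)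
  show ?thesis
    unfolding subspace_iff E
  proof (intro conjI ballI allI)
    show "\<zero> \<in> {x \<in> carrier M. \<exists>k. (D ^^ k) x = \<zero>}" by (auto intro: exI[of _ 0])
    fix x y assume xy: "x \<in> {x \<in> carrier M. \<exists>k. (D ^^ k) x = \<zero>}" "y \<in> {x \<in> carrier M. \<exists>k. (D ^^ k) x = \<zero>}"
    then obtain k l where "(D ^^ k) x = \<zero>" "(D ^^ l) y = \<zero>" by auto
    then have "(D ^^ max k l) x = \<zero>" "(D ^^ max k l) y = \<zero>"
      using funpow_zero_mono[OF D] by (meson max.cobounded1 max.cobounded2)+
    then show "x \<oplus> y \<in> {x \<in> carrier M. \<exists>k. (D ^^ k) x = \<zero>}"
      using xy complex_linear.add[OF Dk, of x y "max k l"] by auto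
  next
    fix d x assume "x \<in> {x \<in> carrier M. \<exists>k. (D ^^ k) x = \<zero>}"
    then obtain k where "x \<in> carrier M" "(D ^^ k) x = \<zero>" by auto
    then show "d \<odot> x \<in> {x \<in> carrier M. \<exists>k. (D ^^ k) x = \<zero>}"
      using complex_linear.smult[OF Dk, of x k d] by auto
  qed auto
qed

text \<open>\<open>D\<close> commutes with its own powers and so preserves the generalized
  eigenspace, and \<open>T x\<close> is \<open>D x\<close> plus a multiple of
  \<open>x\<close>.\<close>

lemma gen_eigenspace_invariant:
  assumes "linear_op M T" "x \<in> gen_eigenspace M T c"
  shows "T x \<in> gen_eigenspace M T c"
proof -
  define D where "D = (\<lambda>y. T y \<ominus> c \<odot> y)"
  have D: "linear_op M D" unfolding D_def by (rule linear_op_diff_smult[OF assms(1)])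
  have x: "x \<in> carrier M" using assms(2) by (simp add: gen_eigenspace_def)
  have E: "gen_eigenspace M T c = {x \<in> carrier M. \<exists>k. (D ^^ k) x = \<zero>}"
    by (simp add: gen_eigenspace_def D_def)
  obtain k where "(D ^^ k) x = \<zero>" using assms(2) E by auto
  then have "(D ^^ k) (D x) = \<zero>"
    using linear_op_zero[OF D] by (simp flip: funpow_swap1)
  then have "D x \<in> gen_eigenspace M T c"
    using linear_op_carrier[OF D x] E by auto
  then have "D x \<oplus> c \<odot> x \<in> gen_eigenspace M T c"
    using gen_eigenspace_subspace[OF assms(1)] assms(2) by (simp add: subspace_add subspace_smult)
  also have "D x \<oplus> c \<odot> x = T x"
    using x linear_op_carrier[OF assms(1) x] by (simp add: D_def diff_add_cancel)
  finally show ?thesis .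
qed

text \<open>On such an \<open>x\<close> the operator T - c acts as the nonzero scalar d - c, so a
  power of it can kill \<open>x\<close> only if \<open>x\<close> is zero.\<close>

lemma gen_eigenspace_no_other_eigenvector:
  assumes T: "linear_op M T" and x: "x \<in> gen_eigenspace M T c" and "T x = d \<odot> x" "d \<noteq> c"
  shows "x = \<zero>"
proof -
  define D where "D = (\<lambda>y. T y \<ominus> c \<odot> y)"
  have xc: "x \<in> carrier M" using x by (simp add: gen_eigenspace_def)
  have Dx: "D x = (d - c) \<odot> x"
    unfolding D_def using xc smult_add_left[of x d "-c"] assms(3)
    by (simp add: M.minus_eq neg_eq_smult smult_smult)
  have D: "complex_linear M M D"
    unfolding D_def using linear_op_diff_smult[OF T] by (simp add: linear_op_iff)
  have "(D ^^ k) x = (d - c) ^ k \<odot> x" for k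
    by (induction k) (use xc Dx complex_linear.smult[OF D xc] in \<open>simp_all add: smult_smult mult.commute\<close>)
  moreover obtain k where "(D ^^ k) x = \<zero>" using x by (auto simp: gen_eigenspace_def D_def)
  ultimately show ?thesis using xc assms(4) smult_eq_zero_iff[of x "(d - c) ^ k"] by auto
qed

end

lemma (in complex_linear) fin_supp_sum:
  assumes "finite {i \<in> I. f i \<noteq> \<zero>\<^bsub>A\<^esub>}" "\<And>i. i \<in> I \<Longrightarrow> f i \<in> carrier A"
  shows "h (fin_supp_sum A f I) = fin_supp_sum B (\<lambda>i. h (f i)) I"
proof -
  let ?F = "{i \<in> I. f i \<noteq> \<zero>\<^bsub>A\<^esub>}"
  have "fin_supp_sum B (\<lambda>i. h (f i)) I = finsum B (\<lambda>i. h (f i)) ?F"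
    by (rule B.fin_supp_sum_eq_finsum) (use assms in auto)
  also have "\<dots> = h (finsum A f ?F)" by (rule finsum[symmetric]) (use assms in auto)
  finally show ?thesis by (simp add: fin_supp_sum_def)
qed

text \<open>
  With \<open>U = exp (c N) - 1\<close> one has \<open>N\<^sup>j U = c N\<^sup>j\<^sup>+\<^sup>1 + (higher powers of N)\<close>. Induction on the order of
  nilpotency puts all \<open>N\<^sup>j U x\<close> into \<open>H\<close>, and then a downward induction extracts the powers of \<open>N\<close>;
  no logarithm series is needed.
\<close>

lemma (in complex_vs) nilpotent_invariant_if_exp_invariant:
  assumes N: "linear_op M N" and H: "subspace_of H M" and c: "c \<noteq> 0"
    and E: "\<And>x. x \<in> H \<Longrightarrow> fin_supp_sum M (\<lambda>k. (c ^ k / fact k) \<odot> (N ^^ k) x) UNIV \<in> H"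
  shows "\<lbrakk>x \<in> H; (N ^^ k) x = \<zero>\<rbrakk> \<Longrightarrow> N x \<in> H"
proof (induction k arbitrary: x)
  case 0
  then show ?case using linear_op_zero[OF N] by simp
next
  case (Suc k)
  have Nj: "complex_linear M M (N ^^ j)" for j
    using linear_op_funpow[OF N] by (simp add: linear_op_iff)
  have x: "x \<in> carrier M" using Suc.prems H subspace_carrier by blast
  have [simp]: "(N ^^ j) x \<in> carrier M" for j using complex_linear.closed[OF Nj x] .
  have zero: "(N ^^ j) x = \<zero>" if "j \<ge> Suc k" for j
    using funpow_zero_mono[OF N Suc.prems(2) that] .
  define a where "a l = c ^ l / fact l" for l
  define R where "R = (\<Oplus>l\<in>{2..<k + 2}. a l \<odot> (N ^^ l) x)"
  define y where "y = c \<odot> N x \<oplus> R"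
  have Nx: "N x \<in> carrier M" using linear_op_carrier[OF N x] .
  have R: "R \<in> carrier M" by (simp add: R_def)
  have y: "y \<in> carrier M" using Nx R by (simp add: y_def)
  \<comment> \<open>All terms with l > k vanish. The bound \<open>k + 2\<close> admits one zero
    term, so that the indices 0 and 1 can be split off even when k = 0.\<close>
  have F: "{..<k + 2} = insert 0 (insert 1 {2..<k + 2})" by auto
  have "fin_supp_sum M (\<lambda>k. a k \<odot> (N ^^ k) x) UNIV = (\<Oplus>l\<in>{..<k + 2}. a l \<odot> (N ^^ l) x)"
    by (rule fin_supp_sum_eq_finsum) (use zero in auto)
  also have "\<dots> = x \<oplus> y"
    unfolding F using x Nx R by (simp add: R_def y_def a_def)
  finally have "x \<oplus> y \<in> H" using E[OF Suc.prems(1)] by (simp add: a_def)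
  then have "x \<oplus> y \<ominus> x \<in> H" using subspace_diff[OF H] Suc.prems(1) by blast
  then have yH: "y \<in> H" using x y add_diff_cancel[of y x] by (simp add: M.a_comm)
  have Njy: "(N ^^ j) y = c \<odot> (N ^^ Suc j) x \<oplus> (\<Oplus>l\<in>{2..<k + 2}. a l \<odot> (N ^^ (l + j)) x)" for j
  proof -
    interpret Nj: complex_linear M M "N ^^ j" by (rule Nj)
    have *: "(N ^^ j) ((N ^^ l) x) = (N ^^ (l + j)) x" for l
      by (simp add: funpow_add add.commute[of l j])
    have "(N ^^ j) R = (\<Oplus>l\<in>{2..<k + 2}. (N ^^ j) (a l \<odot> (N ^^ l) x))"
      unfolding R_def by (rule Nj.finsum) simp
    also have "\<dots> = (\<Oplus>l\<in>{2..<k + 2}. a l \<odot> (N ^^ (l + j)) x)"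
      by (rule M.finsum_cong') (simp_all add: Nj.smult *)
    finally show ?thesis
      using Nx R *[of 1] by (simp add: y_def Nj.add Nj.smult)
  qed
  \<comment> \<open>Since l is at least 2, every exponent here exceeds k. Thus \<open>N ^^ k\<close>
    kills \<open>y\<close>, and the induction hypothesis covers \<open>y\<close> and all its images
    \<open>(N ^^ j) y\<close>.\<close>
  have "(\<Oplus>l\<in>{2..<k + 2}. a l \<odot> (N ^^ (l + k)) x) = \<zero>"
    by (rule finsum_zeros) (use zero in auto)
  then have "(N ^^ k) y = \<zero>"
    unfolding Njy using zero[of "Suc k"] by simp
  then have kj: "(N ^^ k) ((N ^^ j) y) = \<zero>" for j
    using complex_linear.zero[OF Nj, of j] by (metis add.commute comp_apply funpow_add)
  have yj: "(N ^^ j) y \<in> H" for j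
  proof (induction j)
    case (Suc j)
    then show ?case using Suc.IH Suc(1) \<open>\<And>x. x \<in> H \<Longrightarrow> (N ^^ k) x = \<zero> \<Longrightarrow> N x \<in> H\<close> kj by simp
  qed (use yH in simp)
  have "(N ^^ Suc m) x \<in> H" for m
  proof (induction "Suc k - m" arbitrary: m rule: less_induct)
    case less
    show ?case
    proof (cases "m \<ge> k")
      case True
      then show ?thesis using zero[of "Suc m"] subspace_zero[OF H] by simp
    next
      case False
      let ?S = "\<Oplus>l\<in>{2..<k + 2}. a l \<odot> (N ^^ (l + m)) x"
      have "?S \<in> H"
      proof (rule subspace_finsum[OF H])
        fix l assume l: "l \<in> {2..<k + 2}"
        then obtain l' where l': "l = Suc (Suc l')" by (metis atLeastLessThan_iff add_2_eq_Suc le_Suc_ex)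
        have "(N ^^ Suc (Suc l' + m)) x \<in> H" by (rule less) (use False in auto)
        then show "a l \<odot> (N ^^ (l + m)) x \<in> H" using subspace_smult[OF H] l' by simp
      qed
      then have "(N ^^ m) y \<ominus> ?S \<in> H" using yj subspace_diff[OF H] by blast
      also have "(N ^^ m) y \<ominus> ?S = c \<odot> (N ^^ Suc m) x"
        unfolding Njy by (rule add_diff_cancel) (auto simp del: funpow.simps)
      finally have "inverse c \<odot> (c \<odot> (N ^^ Suc m) x) \<in> H" using subspace_smult[OF H] by blast
      then show ?thesis using c by (simp add: smult_smult del: funpow.simps)
    qed
  qed
  from this[of 0] show ?case by simp
qed

text \<open>Unlike \<open>direct_sum_on\<close>, this does not ask the family to span. Generalized
  eigenspaces on the quotient are independent before it is known that they exhaust the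
  space.\<close>

definition independent_family :: "(complex, 'a, 'm) module_scheme \<Rightarrow> 'i set \<Rightarrow> ('i \<Rightarrow> 'a set) \<Rightarrow> bool"
  where "independent_family M I C \<longleftrightarrow> (\<forall>F f. finite F \<and> F \<subseteq> I \<and> (\<forall>i\<in>F. f i \<in> C i) \<and>
    finsum M f F = \<zero>\<^bsub>M\<^esub> \<longrightarrow> (\<forall>i\<in>F. f i = \<zero>\<^bsub>M\<^esub>))"

text \<open>Induction on the number of eigenvalues. A power of T - c annihilates the term at c and
  keeps the others in their generalized eigenspaces, where the induction hypothesis makes them zero;
  as T - c is injective there, the original terms are zero as well.\<close>

lemma (in complex_vs) gen_eigenspaces_independent:
  assumes T: "linear_op M T"
  shows "independent_family M UNIV (gen_eigenspace M T)"
proof -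
  have "\<forall>c\<in>F. f c = \<zero>"
    if "finite F" "\<forall>c\<in>F. f c \<in> gen_eigenspace M T c" "finsum M f F = \<zero>" for F f
    using that
  proof (induction F arbitrary: f rule: finite_induct)
    case (insert c F)
    define D where "D = (\<lambda>y. T y \<ominus> c \<odot> y)"
    have D: "linear_op M D" unfolding D_def by (rule linear_op_diff_smult[OF T])
    have Dk: "complex_linear M M (D ^^ k)" for k
      using linear_op_funpow[OF D] by (simp add: linear_op_iff)
    have fc: "f d \<in> carrier M" if "d \<in> insert c F" for d
      using insert.prems(1) that by (auto simp: gen_eigenspace_def)
    have inv: "(D ^^ k) x \<in> gen_eigenspace M T d" if "x \<in> gen_eigenspace M T d" for k d x
    proof (induction k)
      case (Suc k)
      then have "T ((D ^^ k) x) \<ominus> c \<odot> ((D ^^ k) x) \<in> gen_eigenspace M T d"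
        by (intro subspace_diff subspace_smult gen_eigenspace_subspace gen_eigenspace_invariant T)
      then show ?case by (simp add: D_def)
    qed (use that in simp)
    obtain k where k: "(D ^^ k) (f c) = \<zero>"
      using insert.prems(1) by (auto simp: gen_eigenspace_def D_def)
    have "(D ^^ k) (f c \<oplus> finsum M f F) = \<zero>"
      using insert fc complex_linear.zero[OF Dk] by (simp add: Pi_def)
    then have "finsum M (\<lambda>d. (D ^^ k) (f d)) F = \<zero>"
      using k fc by (simp add: complex_linear.add[OF Dk] complex_linear.finsum[OF Dk] complex_linear.closed[OF Dk] Pi_def)
    then have *: "(D ^^ k) (f d) = \<zero>" if "d \<in> F" for d
      using insert.IH[of "\<lambda>d. (D ^^ k) (f d)"] insert.prems(1) inv that by blast
    \<comment> \<open>The last nonzero \<open>(D ^^ j) x\<close> would be an eigenvector of T for c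
      inside the generalized eigenspace of d.\<close>
    have zero: "x = \<zero>" if "(D ^^ j) x = \<zero>" "x \<in> gen_eigenspace M T d" "d \<noteq> c" for j d x
      using that(1)
    proof (induction j)
      case (Suc j)
      let ?y = "(D ^^ j) x"
      have y: "?y \<in> gen_eigenspace M T d" using inv that(2) by blast
      then have yc: "?y \<in> carrier M" "T ?y \<in> carrier M"
        using linear_op_carrier[OF T] by (auto simp: gen_eigenspace_def)
      have "T ?y \<ominus> c \<odot> ?y = \<zero>" using Suc.prems fun_cong[OF D_def, of ?y] by simp
      then have "T ?y = c \<odot> ?y" using yc by (simp only: diff_eq_zero_iff smult_carrier)
      then have "?y = \<zero>" using gen_eigenspace_no_other_eigenvector[OF T y] that(3) by auto
      then show ?case using Suc.IH by simp
    qed simp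
    have F0: "f d = \<zero>" if "d \<in> F" for d
      using zero[OF *] that insert.prems(1) insert.hyps(2) by blast
    then have "f c = \<zero>"
      using insert.prems(2) insert.hyps fc finsum_zeros[of F f] by (simp add: Pi_def)
    with F0 show ?case by auto
  qed simp
  then show ?thesis unfolding independent_family_def by blast
qed

section \<open>Direct sums\<close>

text \<open>Meaningful only where the decomposition of \<open>x\<close> is unique. Kept outside a
  locale so that projections taken with respect to different families of subspaces can be
  compared.\<close>

definition component ::
    "(complex, 'a, 'm) module_scheme \<Rightarrow> 'i set \<Rightarrow> ('i \<Rightarrow> 'a set) \<Rightarrow> 'i \<Rightarrow> 'a \<Rightarrow> 'a"
  where "component M I C i x = (THE f. f \<in> PiE I C \<and> finite {i \<in> I. f i \<noteq> \<zero>\<^bsub>M\<^esub>} \<and>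
    x = fin_supp_sum M f I) i"

text \<open>The restriction to I matters because \<open>hom_space_Q\<close> identifies the two
  families of subspaces on \<open>hom_index\<close> alone.\<close>

lemma component_cong:
  assumes "\<And>i. i \<in> I \<Longrightarrow> C i = C' i"
  shows "component M I C = component M I C'"
  using PiE_cong[of I C C'] assms by (simp add: component_def fun_eq_iff)

lemma direct_sum_on_cong:
  assumes "\<And>i. i \<in> I \<Longrightarrow> C i = C' i"
  shows "direct_sum_on M D I C = direct_sum_on M D I C'"
  using PiE_cong[of I C C'] assms by (simp add: direct_sum_on_def)

lemma independent_familyD:
  assumes "independent_family M I C" "finite F" "F \<subseteq> I" "\<And>i. i \<in> F \<Longrightarrow> f i \<in> C i"
    "finsum M f F = \<zero>\<^bsub>M\<^esub>" "i \<in> F"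
  shows "f i = \<zero>\<^bsub>M\<^esub>"
  using assms(1)[unfolded independent_family_def, rule_format, of F f i] assms(2-) by blast

locale graded_space = complex_vs M
  for M :: "(complex, 'a, 'm) module_scheme" (structure) +
  fixes I :: "'i set" and C :: "'i \<Rightarrow> 'a set"
  assumes direct_sum: "direct_sum_on M (carrier M) I C"
begin

abbreviation pr :: "'i \<Rightarrow> 'a \<Rightarrow> 'a"
  where "pr \<equiv> component M I C"

abbreviation supp :: "'a \<Rightarrow> 'i set"
  where "supp x \<equiv> {i \<in> I. pr i x \<noteq> \<zero>}"

lemma subspace: "i \<in> I \<Longrightarrow> subspace_of (C i) M"
  using direct_sum by (auto simp: direct_sum_on_def)

lemma carrier: "i \<in> I \<Longrightarrow> x \<in> C i \<Longrightarrow> x \<in> carrier M"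
  using subspace subspace_carrier by blast

lemma
  assumes "x \<in> carrier M"
  shows pr_PiE: "(\<lambda>i. pr i x) \<in> PiE I C"
    and finite_supp [simp]: "finite (supp x)"
    and fin_supp_sum_pr: "fin_supp_sum M (\<lambda>i. pr i x) I = x"
proof -
  have "\<exists>!f. f \<in> PiE I C \<and> finite {i \<in> I. f i \<noteq> \<zero>} \<and> x = fin_supp_sum M f I"
    using direct_sum assms by (simp add: direct_sum_on_def)
  from theI'[OF this]
  show "(\<lambda>i. pr i x) \<in> PiE I C" "finite (supp x)" "fin_supp_sum M (\<lambda>i. pr i x) I = x"
    unfolding component_def by auto
qed

lemma pr_in: "x \<in> carrier M \<Longrightarrow> i \<in> I \<Longrightarrow> pr i x \<in> C i"
  using pr_PiE by (auto simp: PiE_iff)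

lemma pr_carrier [simp]: "x \<in> carrier M \<Longrightarrow> i \<in> I \<Longrightarrow> pr i x \<in> carrier M"
  using pr_in carrier by blast

lemma finsum_pr:
  assumes "x \<in> carrier M" "finite F" "supp x \<subseteq> F" "F \<subseteq> I"
  shows "(\<Oplus>i\<in>F. pr i x) = x"
proof -
  have "fin_supp_sum M (\<lambda>i. pr i x) I = (\<Oplus>i\<in>F. pr i x)"
    by (rule fin_supp_sum_eq_finsum) (use assms in auto)
  then show ?thesis using fin_supp_sum_pr[OF assms(1)] by simp
qed

lemma pr_unique:
  assumes "finite F" "F \<subseteq> I" "\<And>i. i \<in> F \<Longrightarrow> f i \<in> C i" "i \<in> I"
  shows "pr i (finsum M f F) = (if i \<in> F then f i else \<zero>)"
proof -
  \<comment> \<open>\<open>PiE\<close> forces the value \<open>undefined\<close> outside I, whereas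
    indices of I outside F must get zero.\<close>
  define h where "h = (\<lambda>i\<in>I. if i \<in> F then f i else \<zero>)"
  have fc: "f \<in> F \<rightarrow> carrier M" using assms carrier by blast
  then have x: "finsum M f F \<in> carrier M" by simp
  have "\<exists>!f'. f' \<in> PiE I C \<and> finite {i \<in> I. f' i \<noteq> \<zero>} \<and> finsum M f F = fin_supp_sum M f' I"
    using direct_sum x by (simp add: direct_sum_on_def)
  moreover have "h \<in> PiE I C" using assms subspace_zero[OF subspace] by (auto simp: h_def)
  moreover have "finite {i \<in> I. h i \<noteq> \<zero>}"
    by (rule finite_subset[OF _ assms(1)]) (auto simp: h_def)
  moreover have "fin_supp_sum M h I = finsum M h F"
    by (rule fin_supp_sum_eq_finsum) (use assms fc in \<open>auto simp: h_def Pi_def\<close>)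
  moreover have "finsum M h F = finsum M f F"
    by (rule M.finsum_cong') (use assms fc in \<open>auto simp: h_def\<close>)
  ultimately have "(THE f'. f' \<in> PiE I C \<and> finite {i \<in> I. f' i \<noteq> \<zero>} \<and>
      finsum M f F = fin_supp_sum M f' I) = h"
    by (intro the1_equality) auto
  then show ?thesis using assms(4) by (simp add: component_def h_def)
qed

lemma pr_of_component:
  assumes "j \<in> I" "x \<in> C j" "i \<in> I"
  shows "pr i x = (if i = j then x else \<zero>)"
  using pr_unique[of "{j}" "\<lambda>_. x" i] assms carrier[of j x] by auto

text \<open>Expanding both vectors over the union of their supports exhibits a decomposition of the
  sum, to which \<open>pr_unique\<close> applies.\<close>

lemma pr_linear:
  assumes "i \<in> I"
  shows "complex_linear M M (pr i)"
proof (unfold_locales)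
  fix x y assume xy: "x \<in> carrier M" "y \<in> carrier M"
  let ?F = "supp x \<union> supp y"
  have "x \<oplus> y = (\<Oplus>i\<in>?F. pr i x) \<oplus> (\<Oplus>i\<in>?F. pr i y)"
    using finsum_pr[OF xy(1), of ?F] finsum_pr[OF xy(2), of ?F] xy by auto
  also have "\<dots> = (\<Oplus>i\<in>?F. pr i x \<oplus> pr i y)"
    using xy by (intro M.finsum_addf [symmetric]) auto
  finally have eq: "x \<oplus> y = (\<Oplus>i\<in>?F. pr i x \<oplus> pr i y)" .
  have "pr i (x \<oplus> y) = (if i \<in> ?F then pr i x \<oplus> pr i y else \<zero>)"
    unfolding eq by (rule pr_unique) (use xy assms in \<open>auto intro: subspace_add[OF subspace] pr_in\<close>)
  then show "pr i (x \<oplus> y) = pr i x \<oplus> pr i y" using assms by auto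
next
  fix c x assume x: "x \<in> carrier M"
  have "c \<odot> x = c \<odot> (\<Oplus>i\<in>supp x. pr i x)"
    using finsum_pr[OF x, of "supp x"] x by auto
  also have "\<dots> = (\<Oplus>i\<in>supp x. c \<odot> pr i x)"
    using x by (intro finsum_smult_ldistr) auto
  finally have eq: "c \<odot> x = (\<Oplus>i\<in>supp x. c \<odot> pr i x)" .
  have "pr i (c \<odot> x) = (if i \<in> supp x then c \<odot> pr i x else \<zero>)"
    unfolding eq by (rule pr_unique) (use x assms in \<open>auto intro: subspace_smult[OF subspace] pr_in\<close>)
  then show "pr i (c \<odot> x) = c \<odot> pr i x" using assms by auto
qed (use assms in auto)

lemma pr_zero [simp]: "i \<in> I \<Longrightarrow> pr i \<zero> = \<zero>"
  using complex_linear.zero[OF pr_linear] .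

lemma eq_zero_if_pr:
  assumes "x \<in> carrier M" "\<And>i. i \<in> I \<Longrightarrow> pr i x = \<zero>"
  shows "x = \<zero>"
  using finsum_pr[OF assms(1), of "{}"] assms(2) by simp

lemma eq_pr:
  assumes "x \<in> carrier M" "i \<in> I" "\<And>j. j \<in> I \<Longrightarrow> j \<noteq> i \<Longrightarrow> pr j x = \<zero>"
  shows "pr i x = x"
proof -
  have "(\<Oplus>j\<in>{i}. pr j x) = x" by (rule finsum_pr) (use assms in auto)
  then show ?thesis using assms by simp
qed

text \<open>Uniqueness of decompositions is inherited from the ambient space. Gradedness of J thus
  becomes a closure condition on single elements, a form that passes to unions of chains and to
  preimages.\<close>

lemma direct_sum_on_subspace_iff:
  assumes J: "subspace_of J M"
  shows "direct_sum_on M J I (\<lambda>i. J \<inter> C i) \<longleftrightarrow> (\<forall>x\<in>J. \<forall>i\<in>I. pr i x \<in> J)"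
proof
  assume D: "direct_sum_on M J I (\<lambda>i. J \<inter> C i)"
  show "\<forall>x\<in>J. \<forall>i\<in>I. pr i x \<in> J"
  proof (intro ballI)
    fix x i assume x: "x \<in> J" and i: "i \<in> I"
    from D x obtain f where f: "f \<in> PiE I (\<lambda>i. J \<inter> C i)" "finite {i \<in> I. f i \<noteq> \<zero>}"
        "x = fin_supp_sum M f I"
      unfolding direct_sum_on_def by blast
    let ?F = "{i \<in> I. f i \<noteq> \<zero>}"
    have "pr i (finsum M f ?F) = (if i \<in> ?F then f i else \<zero>)"
      by (rule pr_unique) (use f i in \<open>auto simp: PiE_iff\<close>)
    then show "pr i x \<in> J"
      using f i subspace_zero[OF J] by (auto simp: fin_supp_sum_def PiE_iff)
  qed
next
  assume P: "\<forall>x\<in>J. \<forall>i\<in>I. pr i x \<in> J"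
  show "direct_sum_on M J I (\<lambda>i. J \<inter> C i)"
    unfolding direct_sum_on_def
  proof (intro conjI ballI)
    fix i assume "i \<in> I"
    then show "subspace_of (J \<inter> C i) M" using J subspace by (intro subspace_Int) auto
    show "J \<inter> C i \<subseteq> J" by auto
  next
    fix x assume x: "x \<in> J"
    then have xc: "x \<in> carrier M" using subspace_carrier[OF J] by auto
    show "\<exists>!f. f \<in> PiE I (\<lambda>i. J \<inter> C i) \<and> finite {i \<in> I. f i \<noteq> \<zero>} \<and> x = fin_supp_sum M f I"
    proof (rule ex_ex1I)
      have "(\<lambda>i. pr i x) \<in> PiE I (\<lambda>i. J \<inter> C i)"
        using pr_PiE[OF xc] P x by (auto simp: PiE_iff)
      then show "\<exists>f. f \<in> PiE I (\<lambda>i. J \<inter> C i) \<and> finite {i \<in> I. f i \<noteq> \<zero>} \<and> x = fin_supp_sum M f I"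
        using fin_supp_sum_pr[OF xc] finite_supp[OF xc] by (intro exI[of _ "\<lambda>i. pr i x"]) auto
      fix f f'
      assume "f \<in> PiE I (\<lambda>i. J \<inter> C i) \<and> finite {i \<in> I. f i \<noteq> \<zero>} \<and> x = fin_supp_sum M f I"
        and "f' \<in> PiE I (\<lambda>i. J \<inter> C i) \<and> finite {i \<in> I. f' i \<noteq> \<zero>} \<and> x = fin_supp_sum M f' I"
      moreover have "PiE I (\<lambda>i. J \<inter> C i) \<subseteq> PiE I C" by (auto simp: PiE_iff)
      moreover have "\<exists>!f. f \<in> PiE I C \<and> finite {i \<in> I. f i \<noteq> \<zero>} \<and> x = fin_supp_sum M f I"
        using direct_sum xc by (simp add: direct_sum_on_def)
      ultimately show "f = f'" by blast
    qed
  qed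
qed

lemma independent: "independent_family M I C"
  unfolding independent_family_def
proof (intro allI impI ballI, elim conjE)
  fix F f i assume *: "finite F" "F \<subseteq> I" "\<forall>i\<in>F. f i \<in> C i" "finsum M f F = \<zero>" "i \<in> F"
  then show "f i = \<zero>" using pr_unique[of F f i] by auto
qed

text \<open>The map \<open>e\<close> coarsens the grading: a triple goes to its weight, its parity
  or its eigenvalue of g. The components of \<open>y\<close> grouped by \<open>e\<close>, and
  \<open>y\<close> itself placed in degree \<open>c\<close>, express the same vector in the
  independent family D. So every group of a degree other than \<open>c\<close> vanishes, and with it
  each component in the group.\<close>

lemma pr_eq_zero:
  assumes ind: "independent_family M K D" and D: "\<And>e. e \<in> K \<Longrightarrow> subspace_of (D e) M"
    and e: "\<And>i. i \<in> I \<Longrightarrow> e i \<in> K \<and> C i \<subseteq> D (e i)"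
    and y: "y \<in> D c" "c \<in> K" and i: "i \<in> I" "e i \<noteq> c"
  shows "pr i y = \<zero>"
proof (cases "i \<in> supp y")
  case True
  have yc: "y \<in> carrier M" using y D subspace_carrier by blast
  \<comment> \<open>\<open>c\<close> is adjoined because possibly no component of \<open>y\<close>
    has coarse degree \<open>c\<close>.\<close>
  define E where "E = insert c (e ` supp y)"
  define G where "G d = (\<Oplus>j\<in>{j \<in> supp y. e j = d}. pr j y)" for d
  have fin: "finite E" using yc by (simp add: E_def)
  have G: "G d \<in> D d" if "d \<in> E" for d
    unfolding G_def
    by (rule subspace_finsum) (use that e yc y pr_in D in \<open>auto simp: E_def\<close>)
  have EK: "E \<subseteq> K" using e y by (auto simp: E_def)
  have Gc: "G d \<in> carrier M" if "d \<in> E" for d using G EK D that subspace_carrier by blast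
  have "finsum M G E = (\<Oplus>j\<in>supp y. pr j y)"
    unfolding G_def by (rule finsum_group) (use yc fin in \<open>auto simp: E_def\<close>)
  then have GE: "finsum M G E = y" using finsum_pr[OF yc, of "supp y"] yc by auto
  have GEc: "G \<in> E \<rightarrow> carrier M" using Gc by blast
  have sum0: "(\<Oplus>d\<in>E. G d \<ominus> (if d = c then y else \<zero>)) = \<zero>"
    using GE yc finsum_delta[OF fin _ yc, of c] finsum_diff[OF fin GEc, of "\<lambda>d. if d = c then y else \<zero>"]
    by (simp add: E_def diff_eq_zero_iff)
  moreover have "G d \<ominus> (if d = c then y else \<zero>) \<in> D d" if "d \<in> E" for d
  proof -
    have "subspace_of (D d) M" using that EK D by blast
    then show ?thesis using G[OF that] y(1) by (simp add: subspace_diff subspace_zero)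
  qed
  ultimately have *: "G d \<ominus> (if d = c then y else \<zero>) = \<zero>" if "d \<in> E" for d
    using independent_familyD[OF ind fin EK, of "\<lambda>d. G d \<ominus> (if d = c then y else \<zero>)"] that by blast
  have "e i \<in> E" using True by (simp add: E_def)
  then have "G (e i) = \<zero>" using *[of "e i"] i Gc by (simp add: diff_eq_zero_iff)
  moreover have "pr i (G (e i)) = (if i \<in> {j \<in> supp y. e j = e i} then pr i y else \<zero>)"
    unfolding G_def
  proof (rule pr_unique)
    show "finite {j \<in> supp y. e j = e i}" by (rule finite_subset[OF _ finite_supp[OF yc]]) auto
  qed (use yc i pr_in in auto)
  ultimately show ?thesis using True i by simp
qed (use i in simp)

end

section \<open>Gradings along a surjective linear map\<close>

locale linear_quotient = complex_linear A B h
  for A :: "(complex, 'a, 'm) module_scheme" and B :: "(complex, 'b, 'n) module_scheme"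
    and h :: "'a \<Rightarrow> 'b" +
  fixes J :: "'a set"
  assumes surj: "h ` carrier A = carrier B"
    and kernel: "x \<in> carrier A \<Longrightarrow> h x = \<zero>\<^bsub>B\<^esub> \<longleftrightarrow> x \<in> J"
begin

lemma eq_iff: "\<lbrakk>x \<in> carrier A; y \<in> carrier A\<rbrakk> \<Longrightarrow> h x = h y \<longleftrightarrow> x \<ominus>\<^bsub>A\<^esub> y \<in> J"
  using kernel[of "x \<ominus>\<^bsub>A\<^esub> y"] by (simp add: diff B.diff_eq_zero_iff)

text \<open>Since J is closed under the projections, the class of a component of \<open>x\<close>
  depends only on the class of \<open>x\<close>, which gives uniqueness. Existence comes from
  applying \<open>h\<close> to the decomposition of a preimage.\<close>

lemma
  assumes "graded_space A I C" and J: "\<And>x i. x \<in> J \<Longrightarrow> x \<in> carrier A \<Longrightarrow> i \<in> I \<Longrightarrow> component A I C i x \<in> J"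
  shows graded_space_image: "graded_space B I (\<lambda>i. h ` C i)"
    and component_image: "\<lbrakk>i \<in> I; x \<in> carrier A\<rbrakk> \<Longrightarrow>
      component B I (\<lambda>i. h ` C i) i (h x) = h (component A I C i x)"
proof -
  interpret G: graded_space A I C by fact
  have well: "h (G.pr i x) = h (G.pr i y)"
    if "h x = h y" "x \<in> carrier A" "y \<in> carrier A" "i \<in> I" for x y i
    using that J[of "x \<ominus>\<^bsub>A\<^esub> y" i] by (simp add: eq_iff complex_linear.diff[OF G.pr_linear])
  have sum: "h x = finsum B (\<lambda>i. h (G.pr i x)) (G.supp x)" if "x \<in> carrier A" for x
    using finsum[of "\<lambda>i. G.pr i x" "G.supp x"] G.finsum_pr[OF that, of "G.supp x"] that by auto
  have uniq: "f i = h (G.pr i x)"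
    if x: "x \<in> carrier A" and f: "f \<in> PiE I (\<lambda>i. h ` C i)" "finite {i \<in> I. f i \<noteq> \<zero>\<^bsub>B\<^esub>}"
      "h x = fin_supp_sum B f I" and i: "i \<in> I" for x f i
  proof -
    let ?F = "{i \<in> I. f i \<noteq> \<zero>\<^bsub>B\<^esub>}"
    \<comment> \<open>Homogeneous lifts of the \<open>f i\<close>. Their sum has these lifts as
      components and the same image as \<open>x\<close>, so \<open>well\<close> compares the
      two.\<close>
    define f' where "f' i = inv_into (C i) h (f i)" for i
    have f': "f' i \<in> C i \<and> h (f' i) = f i" if "i \<in> I" for i
      unfolding f'_def using PiE_mem[OF f(1) that] by (simp add: inv_into_into f_inv_into_f)
    then have f'c: "\<And>i. i \<in> I \<Longrightarrow> f' i \<in> carrier A" using G.carrier by blast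
    have "h x = finsum B (\<lambda>i. h (f' i)) ?F"
      unfolding f(3) fin_supp_sum_def by (rule B.M.finsum_cong') (use f' f'c in auto)
    also have "\<dots> = h (finsum A f' ?F)" using f'c by (intro finsum [symmetric]) auto
    finally have "h (G.pr i x) = h (G.pr i (finsum A f' ?F))"
      using x f'c i by (intro well) (auto simp: Pi_def)
    also have "G.pr i (finsum A f' ?F) = (if i \<in> ?F then f' i else \<zero>\<^bsub>A\<^esub>)"
      by (rule G.pr_unique) (use f f' i in auto)
    finally show ?thesis using f' i by auto
  qed
  have ex: "(\<lambda>i\<in>I. h (G.pr i x)) \<in> PiE I (\<lambda>i. h ` C i) \<and>
      finite {i \<in> I. (\<lambda>i\<in>I. h (G.pr i x)) i \<noteq> \<zero>\<^bsub>B\<^esub>} \<and>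
      h x = fin_supp_sum B (\<lambda>i\<in>I. h (G.pr i x)) I" if x: "x \<in> carrier A" for x
  proof (intro conjI)
    show "(\<lambda>i\<in>I. h (G.pr i x)) \<in> PiE I (\<lambda>i. h ` C i)" using G.pr_in x by auto
    show "finite {i \<in> I. (\<lambda>i\<in>I. h (G.pr i x)) i \<noteq> \<zero>\<^bsub>B\<^esub>}"
      by (rule finite_subset[OF _ G.finite_supp[OF x]]) auto
    have "fin_supp_sum B (\<lambda>i\<in>I. h (G.pr i x)) I = finsum B (\<lambda>i\<in>I. h (G.pr i x)) (G.supp x)"
      by (rule B.fin_supp_sum_eq_finsum) (use x in auto)
    also have "\<dots> = finsum B (\<lambda>i. h (G.pr i x)) (G.supp x)"
      by (rule B.M.finsum_cong') (use x in auto)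
    finally show "h x = fin_supp_sum B (\<lambda>i\<in>I. h (G.pr i x)) I" using sum[OF x] by simp
  qed
  show GB: "graded_space B I (\<lambda>i. h ` C i)"
  proof (unfold_locales, unfold direct_sum_on_def, intro conjI ballI)
    fix i assume "i \<in> I"
    then show "subspace_of (h ` C i) B" using subspace_image G.subspace by blast
    show "h ` C i \<subseteq> carrier B" using \<open>i \<in> I\<close> G.carrier by auto
  next
    fix y assume "y \<in> carrier B"
    then obtain x where x: "x \<in> carrier A" "y = h x" using surj by blast
    show "\<exists>!f. f \<in> PiE I (\<lambda>i. h ` C i) \<and> finite {i \<in> I. f i \<noteq> \<zero>\<^bsub>B\<^esub>} \<and> y = fin_supp_sum B f I"
      unfolding x(2)
    proof (rule ex_ex1I)
      show "\<exists>f. f \<in> PiE I (\<lambda>i. h ` C i) \<and> finite {i \<in> I. f i \<noteq> \<zero>\<^bsub>B\<^esub>} \<and> h x = fin_supp_sum B f I"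
        by (rule exI[of _ "\<lambda>i\<in>I. h (G.pr i x)"], rule ex[OF x(1)])
      fix f f' assume *: "f \<in> PiE I (\<lambda>i. h ` C i) \<and> finite {i \<in> I. f i \<noteq> \<zero>\<^bsub>B\<^esub>} \<and> h x = fin_supp_sum B f I"
        "f' \<in> PiE I (\<lambda>i. h ` C i) \<and> finite {i \<in> I. f' i \<noteq> \<zero>\<^bsub>B\<^esub>} \<and> h x = fin_supp_sum B f' I"
      have "f i = f' i" if "i \<in> I" for i
        using uniq[OF x(1), of f i] uniq[OF x(1), of f' i] * that by simp
      then show "f = f'" using * by (blast intro: PiE_ext)
    qed
  qed
  interpret GB: graded_space B I "\<lambda>i. h ` C i" by (rule GB)
  show "GB.pr i (h x) = h (G.pr i x)" if "i \<in> I" "x \<in> carrier A"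
    using uniq[OF that(2) GB.pr_PiE GB.finite_supp GB.fin_supp_sum_pr[symmetric] that(1)] that(2) by blast
qed

end

section \<open>Quotients of twisted modules\<close>

text \<open>The exponents differ by an integer, and the strip contains only one representative of
  each class modulo the integers.\<close>

lemma exp_2pi_eq_iff:
  assumes "0 \<le> Re \<alpha>" "Re \<alpha> < 1" "0 \<le> Re \<beta>" "Re \<beta> < 1"
  shows "exp (2 * of_real pi * \<i> * \<alpha>) = exp (2 * of_real pi * \<i> * \<beta>) \<longleftrightarrow> \<alpha> = \<beta>"
proof
  assume "exp (2 * of_real pi * \<i> * \<alpha>) = exp (2 * of_real pi * \<i> * \<beta>)"
  then obtain n :: int where "2 * of_real pi * \<i> * \<alpha> = 2 * of_real pi * \<i> * \<beta> + of_int (2 * n) * pi * \<i>"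
    using exp_eq by auto
  then have "(2 * of_real pi * \<i>) * \<alpha> = (2 * of_real pi * \<i>) * (\<beta> + of_int n)"
    by (simp add: algebra_simps)
  then have eq: "\<alpha> = \<beta> + of_int n" by simp
  then have "Re \<alpha> = Re \<beta> + of_int n" by simp
  then have "n = 0" using assms by linarith
  then show "\<alpha> = \<beta>" using eq by simp
qed simp

sublocale lower_bounded_twisted_module \<subseteq> U: complex_vs W
  by (rule complex_vs.intro[OF space])

sublocale lower_bounded_twisted_module \<subseteq> G: graded_space W hom_index "hom_space W"
  by (intro graded_space.intro U.complex_vs_axioms graded_space_axioms.intro grading)

sublocale lower_bounded_twisted_module \<subseteq> P: graded_space W UNIV "parW W"
  by (intro graded_space.intro U.complex_vs_axioms graded_space_axioms.intro fermion_grading)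

context lower_bounded_twisted_module
begin

lemma twisted_submodule_iff:
  "twisted_submodule V W J \<longleftrightarrow> subspace_of J W \<and> (\<forall>x\<in>J. \<forall>i\<in>hom_index. G.pr i x \<in> J) \<and>
    (\<forall>v\<in>carrier V. \<forall>n k. \<forall>x\<in>J. modeW W v n k x \<in> J) \<and>
    (\<forall>x\<in>J. L0W W x \<in> J \<and> Lm1W W x \<in> J \<and> gW W x \<in> J)"
  unfolding twisted_submodule_def using G.direct_sum_on_subspace_iff[of J] by blast

end

section \<open>The space of cosets\<close>

locale twisted_quotient = lower_bounded_twisted_module +
  fixes J
  assumes submodule: "twisted_submodule V W J"
begin

abbreviation Q where "Q \<equiv> quotient_data W J"

definition proj where "proj x = J +>\<^bsub>W\<^esub> x"

lemma J_subspace: "subspace_of J W"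
  and J_pr: "\<And>x i. x \<in> J \<Longrightarrow> i \<in> hom_index \<Longrightarrow> G.pr i x \<in> J"
  and J_mode: "\<And>v n k x. v \<in> carrier V \<Longrightarrow> x \<in> J \<Longrightarrow> modeW W v n k x \<in> J"
  and J_L0: "\<And>x. x \<in> J \<Longrightarrow> L0W W x \<in> J"
  and J_Lm1: "\<And>x. x \<in> J \<Longrightarrow> Lm1W W x \<in> J"
  and J_g: "\<And>x. x \<in> J \<Longrightarrow> gW W x \<in> J"
  using submodule unfolding twisted_submodule_iff by blast+

lemma J_carrier: "x \<in> J \<Longrightarrow> x \<in> carrier W"
  using J_subspace U.subspace_carrier by blast

lemma abelian_subgroup: "abelian_subgroup J W"
  using J_subspace
  by (intro abelian_subgroupI3 additive_subgroup.intro submodule.axioms(1)) (auto intro: U.M.abelian_group_axioms)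

lemma carrier_Q: "carrier Q = proj ` carrier W"
  by (auto simp: quotient_data_def A_RCOSETS_def' proj_def)

lemma zero_Q: "\<zero>\<^bsub>Q\<^esub> = J"
  by (simp add: quotient_data_def)

lemma add_Q: "\<lbrakk>x \<in> carrier W; y \<in> carrier W\<rbrakk> \<Longrightarrow> proj x \<oplus>\<^bsub>Q\<^esub> proj y = proj (x \<oplus>\<^bsub>W\<^esub> y)"
  using abelian_subgroup.a_rcos_sum[OF abelian_subgroup] by (simp add: quotient_data_def proj_def)

lemma proj_self: "x \<in> carrier W \<Longrightarrow> x \<in> proj x"
  unfolding proj_def by (rule abelian_subgroup.a_rcos_self[OF abelian_subgroup])

lemma mem_proj:
  assumes "x \<in> carrier W" "y \<in> proj x"
  shows "y \<in> carrier W" "proj y = proj x"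
proof -
  show "y \<in> carrier W"
    using assms abelian_subgroup.a_elemrcos_carrier[OF abelian_subgroup]
    unfolding proj_def by blast
  show "proj y = proj x"
    using assms abelian_subgroup.a_repr_independence'[OF abelian_subgroup] unfolding proj_def by blast
qed

lemma proj_eq_iff:
  assumes "x \<in> carrier W" "y \<in> carrier W"
  shows "proj x = proj y \<longleftrightarrow> x \<ominus>\<^bsub>W\<^esub> y \<in> J"
proof -
  have "x \<in> proj y \<longleftrightarrow> x \<ominus>\<^bsub>W\<^esub> y \<in> J"
    using abelian_subgroup.a_rcos_module[OF abelian_subgroup assms(2,1)]
    by (simp add: proj_def a_minus_def)
  then show ?thesis using proj_self[OF assms(1)] mem_proj(2)[OF assms(2)] by auto
qed

text \<open>\<open>induced\<close> is a union of cosets over the members of a coset; these all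
  coincide because T y - T x = T (y - x) lies in J.\<close>

lemma induced_proj:
  assumes T: "linear_op W T" "\<And>x. x \<in> J \<Longrightarrow> T x \<in> J" and x: "x \<in> carrier W"
  shows "induced W J T (proj x) = proj (T x)"
proof -
  interpret T: complex_linear W W T using T(1) by (simp add: U.linear_op_iff)
  have "proj (T y) = proj (T x)" if "y \<in> proj x" for y
  proof -
    have y: "y \<in> carrier W" "proj y = proj x" using mem_proj[OF x that] .
    then have "T (y \<ominus>\<^bsub>W\<^esub> x) \<in> J" using proj_eq_iff[OF y(1) x] T(2) by blast
    then show ?thesis using x y(1) proj_eq_iff[of "T y" "T x"] T.diff[of y x] by simp
  qed
  then have "(\<Union>y\<in>proj x. proj (T y)) = (\<Union>y\<in>proj x. proj (T x))" by (rule SUP_cong[OF refl])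
  also have "\<dots> = proj (T x)" using proj_self[OF x] by auto
  finally show ?thesis by (simp only: induced_def proj_def)
qed

lemma smult_Q: "x \<in> carrier W \<Longrightarrow> c \<odot>\<^bsub>Q\<^esub> proj x = proj (c \<odot>\<^bsub>W\<^esub> x)"
proof -
  assume "x \<in> carrier W"
  moreover have "linear_op W (smult W c)"
    by (simp add: linear_op_def U.smult_add_right U.smult_smult mult.commute)
  ultimately show ?thesis
    using induced_proj[of "smult W c" x] U.subspace_smult[OF J_subspace] by (simp add: quotient_data_def)
qed

lemma proj_zero: "proj \<zero>\<^bsub>W\<^esub> = \<zero>\<^bsub>Q\<^esub>"
  using U.subspace_iff J_subspace by (simp add: zero_Q proj_def)

lemma Q_cases:
  assumes "y \<in> carrier Q"
  obtains x where "x \<in> carrier W" "y = proj x"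
  using assms by (auto simp: carrier_Q)

lemma complex_space_Q: "complex_space Q"
proof (rule moduleI)
  show "cring complex_ring" by (rule cring_from_type_algebra)
  show "abelian_group Q"
  proof (rule abelian_groupI)
    fix x assume "x \<in> carrier Q"
    then obtain x' where x': "x' \<in> carrier W" "x = proj x'" by (rule Q_cases)
    then have "proj (\<ominus>\<^bsub>W\<^esub> x') \<oplus>\<^bsub>Q\<^esub> x = \<zero>\<^bsub>Q\<^esub>"
      by (simp add: add_Q U.M.l_neg proj_zero)
    then show "\<exists>y\<in>carrier Q. y \<oplus>\<^bsub>Q\<^esub> x = \<zero>\<^bsub>Q\<^esub>"
      using x' by (auto simp: carrier_Q)
  next
    show "\<zero>\<^bsub>Q\<^esub> \<in> carrier Q" by (simp add: carrier_Q flip: proj_zero)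
  next
    fix x assume "x \<in> carrier Q"
    then show "\<zero>\<^bsub>Q\<^esub> \<oplus>\<^bsub>Q\<^esub> x = x"
      by (auto simp: add_Q elim!: Q_cases simp flip: proj_zero)
  qed (auto simp: add_Q carrier_Q U.M.a_ac)
qed (auto simp: add_Q smult_Q carrier_Q U.smult_add_left U.smult_add_right U.smult_smult)

end

sublocale twisted_quotient \<subseteq> LQ: linear_quotient W "quotient_data W J" proj J
proof (intro linear_quotient.intro complex_linear.intro linear_quotient_axioms.intro
    complex_linear_axioms.intro U.complex_vs_axioms)
  show "complex_vs Q" by (rule complex_vs.intro[OF complex_space_Q])
  fix x y assume "x \<in> carrier W" "y \<in> carrier W"
  then show "proj (x \<oplus>\<^bsub>W\<^esub> y) = proj x \<oplus>\<^bsub>Q\<^esub> proj y" by (simp add: add_Q)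
next
  fix x assume x: "x \<in> carrier W"
  show "(proj x = \<zero>\<^bsub>Q\<^esub>) = (x \<in> J)"
    using proj_eq_iff[OF x, of "\<zero>\<^bsub>W\<^esub>"] U.diff_add_cancel[of x "\<zero>\<^bsub>W\<^esub>"] x by (simp add: proj_zero)
qed (simp_all add: carrier_Q smult_Q)

context twisted_quotient
begin

lemma proj_component:
  "\<lbrakk>x \<in> carrier W; i \<in> hom_index\<rbrakk> \<Longrightarrow>
    component Q hom_index (\<lambda>i. proj ` hom_space W i) i (proj x) = proj (G.pr i x)"
  using LQ.component_image[OF G.graded_space_axioms] J_pr by blast

lemma graded_space_proj_hom: "graded_space Q hom_index (\<lambda>i. proj ` hom_space W i)"
  using LQ.graded_space_image[OF G.graded_space_axioms] J_pr by blast

text \<open>J is by definition graded by triples only. Each triple component has a definite parity,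
  so the parity projection of a member of J is a partial sum of its triple components.\<close>

lemma graded_space_proj_par: "graded_space Q UNIV (\<lambda>s. proj ` parW W s)"
proof (rule LQ.graded_space_image[OF P.graded_space_axioms])
  fix x s assume x: "x \<in> J" "x \<in> carrier W"
  interpret Ps: complex_linear W W "P.pr s" by (rule P.pr_linear) simp
  have "P.pr s (finsum W (\<lambda>i. G.pr i x) (G.supp x)) \<in> J"
    using x
  proof (subst Ps.finsum)
    show "finsum W (\<lambda>i. P.pr s (G.pr i x)) (G.supp x) \<in> J"
    proof (rule U.subspace_finsum[OF J_subspace])
      fix i assume i: "i \<in> G.supp x"
      obtain n t \<alpha> where [simp]: "i = (n, t, \<alpha>)" by (cases i)
      have "G.pr i x \<in> parW W t" using G.pr_in[OF x(2), of i] i by (simp add: hom_space_def)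
      then have "P.pr s (G.pr i x) = (if s = t then G.pr i x else \<zero>\<^bsub>W\<^esub>)"
        using P.pr_of_component by auto
      then show "P.pr s (G.pr i x) \<in> J"
        using J_pr[OF x(1)] i U.subspace_zero[OF J_subspace] by simp
    qed
  qed auto
  then show "P.pr s x \<in> J" using G.finsum_pr[OF x(2), of "G.supp x"] x by simp
qed

lemma parW_Q: "parW Q s = proj ` parW W s"
  by (simp add: quotient_data_def proj_def)

lemma
  shows L0_Q: "L0W Q = induced W J (L0W W)"
    and Lm1_Q: "Lm1W Q = induced W J (Lm1W W)"
    and g_Q: "gW Q = induced W J (gW W)"
    and mode_Q: "modeW Q v n k = induced W J (modeW W v n k)"
  by (simp_all add: quotient_data_def)

lemma linear_op_induced:
  assumes T: "linear_op W T" "\<And>x. x \<in> J \<Longrightarrow> T x \<in> J"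
  shows "linear_op Q (induced W J T)"
proof -
  interpret T: complex_linear W W T using T(1) by (simp add: U.linear_op_iff)
  note [simp] = induced_proj[OF T]
  show ?thesis
    unfolding linear_op_def carrier_Q
    by (auto simp: add_Q smult_Q T.add T.smult)
qed

lemma funpow_induced:
  assumes T: "linear_op W T" "\<And>x. x \<in> J \<Longrightarrow> T x \<in> J" and x: "x \<in> carrier W"
  shows "(induced W J T ^^ k) (proj x) = proj ((T ^^ k) x)"
  by (induction k)
    (simp_all add: induced_proj[OF T] U.linear_op_carrier[OF U.linear_op_funpow[OF T(1)] x])

text \<open>\<open>proj\<close> intertwines T - c with its counterpart on the quotient. The converse
  is not immediate: a class in a generalized eigenspace need not come with a representative in the
  corresponding one of W.\<close>

lemma gen_eigenspace_proj:
  assumes T: "linear_op W T" "\<And>x. x \<in> J \<Longrightarrow> T x \<in> J" and x: "x \<in> gen_eigenspace W T c"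
  shows "proj x \<in> gen_eigenspace Q (induced W J T) c"
proof -
  have xc: "x \<in> carrier W" using x by (simp add: gen_eigenspace_def)
  obtain k where k: "((\<lambda>y. T y \<ominus>\<^bsub>W\<^esub> c \<odot>\<^bsub>W\<^esub> y) ^^ k) x = \<zero>\<^bsub>W\<^esub>"
    using x by (auto simp: gen_eigenspace_def)
  have "((\<lambda>y. induced W J T y \<ominus>\<^bsub>Q\<^esub> c \<odot>\<^bsub>Q\<^esub> y) ^^ k) (proj x) = proj (((\<lambda>y. T y \<ominus>\<^bsub>W\<^esub> c \<odot>\<^bsub>W\<^esub> y) ^^ k) x)" for k
  proof (induction k)
    case (Suc k)
    have D: "linear_op W (\<lambda>y. T y \<ominus>\<^bsub>W\<^esub> c \<odot>\<^bsub>W\<^esub> y)" by (rule U.linear_op_diff_smult[OF T(1)])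
    have "((\<lambda>y. T y \<ominus>\<^bsub>W\<^esub> c \<odot>\<^bsub>W\<^esub> y) ^^ k) x \<in> carrier W"
      by (rule U.linear_op_carrier[OF U.linear_op_funpow[OF D] xc])
    then show ?case
      using Suc.IH by (simp add: induced_proj[OF T] smult_Q U.linear_op_carrier[OF T(1)] LQ.diff)
  qed simp
  then have "((\<lambda>y. induced W J T y \<ominus>\<^bsub>Q\<^esub> c \<odot>\<^bsub>Q\<^esub> y) ^^ k) (proj x) = \<zero>\<^bsub>Q\<^esub>"
    using k by (simp only: proj_zero)
  then show ?thesis unfolding gen_eigenspace_def using xc by blast
qed

end

text \<open>The grading by images; that its summands are the intrinsic homogeneous subspaces is
  \<open>hom_space_Q\<close>, whose proof uses this grading.\<close>

sublocale twisted_quotient \<subseteq> GQ: graded_space "quotient_data W J" hom_index "\<lambda>i. proj ` hom_space W i"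
  by (rule graded_space_proj_hom)

sublocale twisted_quotient \<subseteq> PQ: graded_space "quotient_data W J" UNIV "\<lambda>s. proj ` parW W s"
  by (rule graded_space_proj_par)

context twisted_quotient
begin

lemma L0_linear_Q: "linear_op Q (L0W Q)"
  and Lm1_linear_Q: "linear_op Q (Lm1W Q)"
  and g_linear_Q: "linear_op Q (gW Q)"
  and mode_linear_Q: "v \<in> carrier V \<Longrightarrow> linear_op Q (modeW Q v n k)"
  unfolding L0_Q Lm1_Q g_Q mode_Q
  by (intro linear_op_induced L0_linear Lm1_linear g_linear mode_linear_right J_L0 J_Lm1 J_g J_mode;
      assumption)+

lemma L0_proj: "x \<in> carrier W \<Longrightarrow> L0W Q (proj x) = proj (L0W W x)"
  and Lm1_proj: "x \<in> carrier W \<Longrightarrow> Lm1W Q (proj x) = proj (Lm1W W x)"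
  and g_proj: "x \<in> carrier W \<Longrightarrow> gW Q (proj x) = proj (gW W x)"
  and mode_proj: "v \<in> carrier V \<Longrightarrow> x \<in> carrier W \<Longrightarrow> modeW Q v n k (proj x) = proj (modeW W v n k x)"
  unfolding L0_Q Lm1_Q g_Q mode_Q
  by (intro induced_proj L0_linear Lm1_linear g_linear mode_linear_right J_L0 J_Lm1 J_g J_mode;
      assumption)+

section \<open>Homogeneous subspaces of the quotient\<close>

lemma wt_space_proj: "x \<in> wt_space W n \<Longrightarrow> proj x \<in> wt_space Q n"
  unfolding wt_space_def L0_Q by (intro gen_eigenspace_proj L0_linear J_L0)

lemma gwt_space_proj: "x \<in> gwt_space W \<alpha> \<Longrightarrow> proj x \<in> gwt_space Q \<alpha>"
  unfolding gwt_space_def g_Q by (intro gen_eigenspace_proj g_linear J_g)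

lemma pr_wt_space:
  assumes "y \<in> wt_space Q n" "i \<in> hom_index" "fst i \<noteq> n"
  shows "GQ.pr i y = \<zero>\<^bsub>Q\<^esub>"
proof (rule GQ.pr_eq_zero[where K = UNIV and D = "wt_space Q" and e = fst and c = n])
  show "independent_family Q UNIV (wt_space Q)"
    unfolding wt_space_def using LQ.B.gen_eigenspaces_independent[OF L0_linear_Q] .
  show "\<And>e. subspace_of (wt_space Q e) Q"
    unfolding wt_space_def using LQ.B.gen_eigenspace_subspace[OF L0_linear_Q] .
qed (use assms in \<open>auto simp: hom_space_def wt_space_proj\<close>)

text \<open>\<open>c\<close> is an arbitrary number rather than an exponential, because
  \<open>g_bij_Q\<close> takes it to be 0.\<close>

lemma pr_g_eigenspace:
  assumes "y \<in> gen_eigenspace Q (gW Q) c" "(n, s, \<alpha>) \<in> hom_index" "exp (2 * of_real pi * \<i> * \<alpha>) \<noteq> c"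
  shows "GQ.pr (n, s, \<alpha>) y = \<zero>\<^bsub>Q\<^esub>"
proof (rule GQ.pr_eq_zero[where K = UNIV and D = "gen_eigenspace Q (gW Q)" and
      e = "\<lambda>(n, s, \<alpha>). exp (2 * of_real pi * \<i> * \<alpha>)" and c = c])
  show "independent_family Q UNIV (gen_eigenspace Q (gW Q))"
    using LQ.B.gen_eigenspaces_independent[OF g_linear_Q] .
  show "\<And>e. subspace_of (gen_eigenspace Q (gW Q) e) Q"
    using LQ.B.gen_eigenspace_subspace[OF g_linear_Q] .
  fix i :: "complex \<times> bit \<times> complex" assume "i \<in> hom_index"
  show "(case i of (n, s, \<alpha>) \<Rightarrow> exp (2 * of_real pi * \<i> * \<alpha>)) \<in> UNIV \<and>
    proj ` hom_space W i \<subseteq> gen_eigenspace Q (gW Q) (case i of (n, s, \<alpha>) \<Rightarrow> exp (2 * of_real pi * \<i> * \<alpha>))"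
    using gwt_space_proj by (auto simp: hom_space_def gwt_space_def split: prod.splits)
qed (use assms in auto)

lemma pr_gwt_space:
  assumes "y \<in> gwt_space Q \<beta>" "(n, s, \<alpha>) \<in> hom_index" "0 \<le> Re \<beta>" "Re \<beta> < 1" "\<alpha> \<noteq> \<beta>"
  shows "GQ.pr (n, s, \<alpha>) y = \<zero>\<^bsub>Q\<^esub>"
  using assms by (intro pr_g_eigenspace[of y "exp (2 * of_real pi * \<i> * \<beta>)"])
    (auto simp: gwt_space_def hom_index_def exp_2pi_eq_iff)

lemma pr_parW:
  assumes "y \<in> parW Q t" "(n, s, \<alpha>) \<in> hom_index" "s \<noteq> t"
  shows "GQ.pr (n, s, \<alpha>) y = \<zero>\<^bsub>Q\<^esub>"
proof (rule GQ.pr_eq_zero[where K = UNIV and D = "\<lambda>s. proj ` parW W s" and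
      e = "\<lambda>(n, s, \<alpha>). s" and c = t])
  show "\<And>e. subspace_of (proj ` parW W e) Q" by (rule PQ.subspace) simp
qed (use assms PQ.independent in \<open>auto simp: hom_space_def parW_Q\<close>)

lemma hom_space_Q:
  assumes i: "i \<in> hom_index"
  shows "hom_space Q i = proj ` hom_space W i"
proof
  obtain n s \<alpha> where [simp]: "i = (n, s, \<alpha>)" by (cases i)
  show "proj ` hom_space W i \<subseteq> hom_space Q i"
    by (auto simp: hom_space_def parW_Q wt_space_proj gwt_space_proj)
  show "hom_space Q i \<subseteq> proj ` hom_space W i"
  proof
    fix y assume y: "y \<in> hom_space Q i"
    then have yQ: "y \<in> carrier Q" by (auto simp: hom_space_def wt_space_def gen_eigenspace_def)
    have "GQ.pr j y = \<zero>\<^bsub>Q\<^esub>" if j: "j \<in> hom_index" "j \<noteq> i" for j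
    proof -
      obtain m t \<beta> where [simp]: "j = (m, t, \<beta>)" by (cases j)
      have \<alpha>: "0 \<le> Re \<alpha>" "Re \<alpha> < 1" using i by (auto simp: hom_index_def)
      have y': "y \<in> wt_space Q n" "y \<in> parW Q s" "y \<in> gwt_space Q \<alpha>"
        using y by (auto simp: hom_space_def)
      consider "m \<noteq> n" | "t \<noteq> s" | "\<beta> \<noteq> \<alpha>" using j(2) by auto
      then show ?thesis
        using pr_wt_space[OF y'(1) j(1)] pr_parW[OF y'(2), of m t \<beta>] pr_gwt_space[OF y'(3) _ \<alpha>, of m t \<beta>] j(1)
        by cases auto
    qed
    then have "GQ.pr i y = y" using GQ.eq_pr[OF yQ i] by blast
    then show "y \<in> proj ` hom_space W i" using GQ.pr_in[OF yQ i] by simp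
  qed
qed

lemma grading_Q: "direct_sum_on Q (carrier Q) hom_index (hom_space Q)"
  by (subst direct_sum_on_cong[OF hom_space_Q]) (assumption, rule GQ.direct_sum)

text \<open>A bound for W also serves for the quotient: below it, a component of weight n has a
  representative in \<open>wt_space W n\<close>, which is zero, and components of other weights
  vanish by \<open>pr_wt_space\<close>.\<close>

lemma lower_bound_Q: "\<exists>B. \<forall>n. Re n < B \<longrightarrow> wt_space Q n = {\<zero>\<^bsub>Q\<^esub>}"
proof -
  obtain B where B: "\<And>n. Re n < B \<Longrightarrow> wt_space W n = {\<zero>\<^bsub>W\<^esub>}" using lower_bound by blast
  have "y = \<zero>\<^bsub>Q\<^esub>" if n: "Re n < B" and y: "y \<in> wt_space Q n" for n y
  proof (rule GQ.eq_zero_if_pr)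
    show yQ: "y \<in> carrier Q" using y by (simp add: wt_space_def gen_eigenspace_def)
    then obtain x where x: "x \<in> carrier W" "y = proj x" by (rule Q_cases)
    fix i assume i: "i \<in> hom_index"
    show "GQ.pr i y = \<zero>\<^bsub>Q\<^esub>"
    proof (cases "fst i = n")
      case True
      then have "G.pr i x \<in> wt_space W n" using G.pr_in[OF x(1) i] by (auto simp: hom_space_def)
      then have "G.pr i x = \<zero>\<^bsub>W\<^esub>" using B[OF n] by simp
      then show ?thesis using proj_component[OF x(1) i] x(2) by simp
    qed (use pr_wt_space[OF y i] in simp)
  qed
  moreover have "\<zero>\<^bsub>Q\<^esub> \<in> wt_space Q n" for n
    unfolding wt_space_def using LQ.B.gen_eigenspace_subspace[OF L0_linear_Q] LQ.B.subspace_zero by blast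
  ultimately show ?thesis by blast
qed

text \<open>Invariance only says that g maps J into J, whereas injectivity on the quotient means
  that g x in J implies x in J.\<close>

lemma g_bij_Q: "bij_betw (gW Q) (carrier Q) (carrier Q)"
proof -
  interpret gQ: complex_linear Q Q "gW Q" using g_linear_Q by (simp add: LQ.B.linear_op_iff)
  have ker: "y = \<zero>\<^bsub>Q\<^esub>" if y: "y \<in> carrier Q" "gW Q y = \<zero>\<^bsub>Q\<^esub>" for y
  proof (rule GQ.eq_zero_if_pr[OF y(1)])
    \<comment> \<open>A kernel element is an eigenvector for 0, a value that the exponential never
      takes, so all its components vanish.\<close>
    have "((\<lambda>y. gW Q y \<ominus>\<^bsub>Q\<^esub> 0 \<odot>\<^bsub>Q\<^esub> y) ^^ 1) y = \<zero>\<^bsub>Q\<^esub>"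
      using y by (simp add: LQ.B.diff_eq_zero_iff)
    then have "y \<in> gen_eigenspace Q (gW Q) 0" unfolding gen_eigenspace_def using y(1) by blast
    fix i assume "i \<in> hom_index"
    then show "GQ.pr i y = \<zero>\<^bsub>Q\<^esub>"
      using pr_g_eigenspace[OF \<open>y \<in> gen_eigenspace Q (gW Q) 0\<close>] by (cases i) auto
  qed
  have "inj_on (gW Q) (carrier Q)"
  proof (rule inj_onI)
    fix x y assume xy: "x \<in> carrier Q" "y \<in> carrier Q" "gW Q x = gW Q y"
    then have "gW Q (x \<ominus>\<^bsub>Q\<^esub> y) = \<zero>\<^bsub>Q\<^esub>" by (simp add: gQ.diff LQ.B.diff_eq_zero_iff)
    then show "x = y" using ker[of "x \<ominus>\<^bsub>Q\<^esub> y"] xy by (simp add: LQ.B.diff_eq_zero_iff)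
  qed
  moreover have "gW Q ` carrier Q = carrier Q"
  proof -
    have "gW Q ` carrier Q = proj ` (gW W ` carrier W)"
      unfolding carrier_Q image_image by (intro image_cong refl g_proj)
    then show ?thesis using g_bij by (simp add: bij_betw_def carrier_Q)
  qed
  ultimately show ?thesis by (simp add: bij_betw_def)
qed

text \<open>\<open>exp_form\<close> quantifies over whole g-weight spaces, so all their members, not
  only the homogeneous ones, must be lifted to W.\<close>

lemma gwt_space_Q:
  assumes \<alpha>: "0 \<le> Re \<alpha>" "Re \<alpha> < 1"
  shows "gwt_space Q \<alpha> = proj ` gwt_space W \<alpha>"
proof
  show "gwt_space Q \<alpha> \<subseteq> proj ` gwt_space W \<alpha>"
  proof
    fix y assume y: "y \<in> gwt_space Q \<alpha>"
    then have yQ: "y \<in> carrier Q" by (simp add: gwt_space_def gen_eigenspace_def)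
    then obtain x where x: "x \<in> carrier W" "y = proj x" by (rule Q_cases)
    \<comment> \<open>The representative \<open>x\<close> may have components of other g-weights.
      Dropping them does not change its class, since the corresponding components of
      \<open>y\<close> are zero.\<close>
    define F where "F = {i \<in> G.supp x. snd (snd i) = \<alpha>}"
    have F: "finite F" "F \<subseteq> hom_index"
      unfolding F_def using G.finite_supp[OF x(1)] by (auto elim: rev_finite_subset)
    have supp: "GQ.supp y \<subseteq> F"
    proof
      fix i assume i: "i \<in> GQ.supp y"
      obtain n s \<beta> where nsb: "i = (n, s, \<beta>)" by (cases i)
      have ih: "i \<in> hom_index" and nz: "GQ.pr i y \<noteq> \<zero>\<^bsub>Q\<^esub>" using i by blast+
      have "G.pr i x \<noteq> \<zero>\<^bsub>W\<^esub>"
        using nz unfolding x(2) proj_component[OF x(1) ih] by (metis LQ.zero)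
      moreover have "\<beta> = \<alpha>"
        using pr_gwt_space[OF y _ \<alpha>, of n s \<beta>] ih nz unfolding nsb by blast
      ultimately show "i \<in> F" using ih nsb by (simp add: F_def)
    qed
    have "finsum Q (\<lambda>i. GQ.pr i y) F = y" by (rule GQ.finsum_pr[OF yQ F(1) supp F(2)])
    moreover have "finsum Q (\<lambda>i. GQ.pr i y) F = finsum Q (\<lambda>i. proj (G.pr i x)) F"
      by (rule LQ.B.M.finsum_cong') (use F(2) proj_component x in auto)
    moreover have "\<dots> = proj (finsum W (\<lambda>i. G.pr i x) F)"
      by (rule LQ.finsum[symmetric]) (use F(2) x in auto)
    moreover have "finsum W (\<lambda>i. G.pr i x) F \<in> gwt_space W \<alpha>"
      unfolding gwt_space_def
    proof (rule U.subspace_finsum[OF U.gen_eigenspace_subspace[OF g_linear]])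
      fix i assume i: "i \<in> F"
      then have "G.pr i x \<in> hom_space W i" using G.pr_in[OF x(1)] F(2) by blast
      then show "G.pr i x \<in> gen_eigenspace W (gW W) (exp (2 * complex_of_real pi * \<i> * \<alpha>))"
        using i by (cases i) (auto simp: hom_space_def F_def gwt_space_def)
    qed
    ultimately show "y \<in> proj ` gwt_space W \<alpha>" by auto
  qed
qed (auto simp: gwt_space_proj)

lemma exp_form_Q: "exp_form Q"
proof -
  let ?e = "\<lambda>\<alpha>::complex. exp (2 * of_real pi * \<i> * \<alpha>)"
  let ?c = "2 * complex_of_real pi * \<i>"
  obtain N where N: "linear_op W N" "\<And>x. x \<in> carrier W \<Longrightarrow> \<exists>k. (N ^^ k) x = \<zero>\<^bsub>W\<^esub>"
    and exp: "\<And>\<alpha> x. \<lbrakk>0 \<le> Re \<alpha>; Re \<alpha> < 1; x \<in> gwt_space W \<alpha>\<rbrakk> \<Longrightarrow> N x \<in> gwt_space W \<alpha> \<and>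
      gW W x = ?e \<alpha> \<odot>\<^bsub>W\<^esub> fin_supp_sum W (\<lambda>k. (?c ^ k / fact k) \<odot>\<^bsub>W\<^esub> (N ^^ k) x) UNIV"
    using g_exp unfolding exp_form_def by blast
  have Nk: "(N ^^ k) x \<in> carrier W" if "x \<in> carrier W" for k x
    using U.linear_op_carrier[OF U.linear_op_funpow[OF N(1)] that] .
  have fss: "fin_supp_sum W (\<lambda>k. (?c ^ k / fact k) \<odot>\<^bsub>W\<^esub> (N ^^ k) x) UNIV \<in> carrier W"
    if "x \<in> carrier W" for x
    unfolding fin_supp_sum_def using Nk[OF that] by (intro U.M.finsum_closed) auto
  have NJ: "N x \<in> J" if x: "x \<in> J" for x
  proof -
    have "N (G.pr i x) \<in> J" if i: "i \<in> hom_index" for i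
    proof -
      obtain n s \<alpha> where [simp]: "i = (n, s, \<alpha>)" by (cases i)
      have \<alpha>: "0 \<le> Re \<alpha>" "Re \<alpha> < 1" using i by (auto simp: hom_index_def)
      \<comment> \<open>The exponential formula for g holds on each g-weight space separately, so
        the argument runs on the part of J inside one of them, one component of \<open>x\<close> at
        a time.\<close>
      let ?H = "J \<inter> gwt_space W \<alpha>"
      have H: "subspace_of ?H W"
        unfolding gwt_space_def
        by (intro U.subspace_Int J_subspace U.gen_eigenspace_subspace g_linear)
      have xi: "G.pr i x \<in> ?H"
        using J_pr[OF x i] G.pr_in[OF J_carrier[OF x] i] by (auto simp: hom_space_def)
      obtain k where k: "(N ^^ k) (G.pr i x) = \<zero>\<^bsub>W\<^esub>"
        using N(2)[of "G.pr i x"] J_carrier[OF x] i by auto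
      have "N (G.pr i x) \<in> ?H"
      proof (rule U.nilpotent_invariant_if_exp_invariant[OF N(1) H _ _ xi k])
        show "?c \<noteq> 0" by simp
        fix z assume z: "z \<in> ?H"
        let ?S = "fin_supp_sum W (\<lambda>k. (?c ^ k / fact k) \<odot>\<^bsub>W\<^esub> (N ^^ k) z) UNIV"
        have "gW W z \<in> ?H"
          using z J_g U.gen_eigenspace_invariant[OF g_linear] by (auto simp: gwt_space_def)
        \<comment> \<open>Dividing g z by its scalar factor leaves the exponential of 2 pi i N
          applied to z.\<close>
        then have "inverse (?e \<alpha>) \<odot>\<^bsub>W\<^esub> (?e \<alpha> \<odot>\<^bsub>W\<^esub> ?S) \<in> ?H"
          using exp[OF \<alpha>, of z] z U.subspace_smult[OF H] by auto
        then show "?S \<in> ?H" using fss[of z] z J_carrier by (simp add: U.smult_smult)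
      qed
      then show ?thesis by blast
    qed
    then have "finsum W (\<lambda>i. N (G.pr i x)) (G.supp x) \<in> J"
      by (intro U.subspace_finsum[OF J_subspace]) auto
    moreover have "N (finsum W (\<lambda>i. G.pr i x) (G.supp x)) = finsum W (\<lambda>i. N (G.pr i x)) (G.supp x)"
      by (rule complex_linear.finsum) (use N(1) J_carrier[OF x] in \<open>auto simp: U.linear_op_iff\<close>)
    ultimately show ?thesis using G.finsum_pr[OF J_carrier[OF x], of "G.supp x"] J_carrier[OF x] by simp
  qed
  have pN: "induced W J N (proj x) = proj (N x)" if "x \<in> carrier W" for x
    by (rule induced_proj[OF N(1) NJ that])
  have pNk: "(induced W J N ^^ k) (proj x) = proj ((N ^^ k) x)" if "x \<in> carrier W" for x k
    by (rule funpow_induced[OF N(1) NJ that])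
  show ?thesis
    unfolding exp_form_def
  proof (intro exI[of _ "induced W J N"] conjI ballI allI impI)
    show "linear_op Q (induced W J N)" by (rule linear_op_induced[OF N(1) NJ])
    fix y assume "y \<in> carrier Q"
    then obtain x where x: "x \<in> carrier W" "y = proj x" by (rule Q_cases)
    then show "\<exists>k. (induced W J N ^^ k) y = \<zero>\<^bsub>Q\<^esub>"
      using N(2)[OF x(1)] pNk[OF x(1)] proj_zero by metis
  next
    fix \<alpha> y assume \<alpha>: "0 \<le> Re \<alpha> \<and> Re \<alpha> < 1" and "y \<in> gwt_space Q \<alpha>"
    then obtain x where x: "x \<in> gwt_space W \<alpha>" "y = proj x" using gwt_space_Q by blast
    have xc: "x \<in> carrier W" using x(1) by (simp add: gwt_space_def gen_eigenspace_def)
    show "induced W J N y \<in> gwt_space Q \<alpha>"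
      using exp[of \<alpha> x] \<alpha> x xc by (auto simp: pN gwt_space_proj)
    let ?f = "\<lambda>k. (?c ^ k / fact k) \<odot>\<^bsub>W\<^esub> (N ^^ k) x"
    obtain k where k: "(N ^^ k) x = \<zero>\<^bsub>W\<^esub>" using N(2)[OF xc] by blast
    have "?f i = \<zero>\<^bsub>W\<^esub>" if "\<not> i < k" for i
      using U.funpow_zero_mono[OF N(1) k, of i] that by simp
    \<comment> \<open>Finite support in W lets \<open>proj\<close> pass through the sum; the support
      in the quotient may be smaller.\<close>
    then have "{i \<in> UNIV. ?f i \<noteq> \<zero>\<^bsub>W\<^esub>} \<subseteq> {..<k}" by blast
    then have fin: "finite {i \<in> UNIV. ?f i \<noteq> \<zero>\<^bsub>W\<^esub>}" by (rule finite_subset) simp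
    have "gW Q y = proj (?e \<alpha> \<odot>\<^bsub>W\<^esub> fin_supp_sum W ?f UNIV)"
      using exp[of \<alpha> x] \<alpha> x xc by (simp add: g_proj)
    also have "\<dots> = ?e \<alpha> \<odot>\<^bsub>Q\<^esub> proj (fin_supp_sum W ?f UNIV)"
      by (simp add: smult_Q fss xc)
    also have "proj (fin_supp_sum W ?f UNIV) = fin_supp_sum Q (\<lambda>k. proj (?f k)) UNIV"
      by (rule LQ.fin_supp_sum[OF fin]) (simp add: Nk xc)
    also have "(\<lambda>k. proj (?f k)) = (\<lambda>k. (?c ^ k / fact k) \<odot>\<^bsub>Q\<^esub> (induced W J N ^^ k) y)"
      by (simp add: x(2) pNk[OF xc] smult_Q Nk xc)
    finally show "gW Q y = ?e \<alpha> \<odot>\<^bsub>Q\<^esub>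
      fin_supp_sum Q (\<lambda>k. (?c ^ k / fact k) \<odot>\<^bsub>Q\<^esub> (induced W J N ^^ k) y) UNIV" .
  qed
qed

text \<open>The bridge for the analytic axioms: matrix coefficients of the quotient against \<phi>
  are those of W against the pulled-back functional. Its support stays finite because
  \<open>proj\<close> preserves degrees.\<close>

lemma graded_dual_proj:
  assumes "\<phi> \<in> graded_dual Q"
  shows "(\<lambda>x. \<phi> (proj x)) \<in> graded_dual W"
proof -
  from assms have lin: "linear_functional Q \<phi>"
    and fin: "finite {i \<in> hom_index. \<exists>x\<in>hom_space Q i. \<phi> x \<noteq> 0}"
    by (auto simp: graded_dual_def)
  have "linear_functional W (\<lambda>x. \<phi> (proj x))"
    using lin unfolding linear_functional_def carrier_Q by (auto simp flip: add_Q smult_Q)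
  moreover have "finite {i \<in> hom_index. \<exists>x\<in>hom_space W i. \<phi> (proj x) \<noteq> 0}"
    by (rule finite_subset[OF _ fin]) (auto simp: hom_space_Q)
  ultimately show ?thesis by (simp add: graded_dual_def)
qed

lemma mode_carrier: "\<lbrakk>v \<in> carrier V; x \<in> carrier W\<rbrakk> \<Longrightarrow> modeW W v n k x \<in> carrier W"
  using U.linear_op_carrier[OF mode_linear_right] .

lemma ddxW_proj:
  assumes "v \<in> carrier V" "x \<in> carrier W"
  shows "ddxW Q (\<lambda>n k. modeW Q v n k (proj x)) n k = proj (ddxW W (\<lambda>n k. modeW W v n k x) n k)"
  using assms by (simp add: ddxW_def mode_proj mode_carrier smult_Q add_Q)

lemma one_term_proj:
  "\<lbrakk>v \<in> carrier V; x \<in> carrier W\<rbrakk> \<Longrightarrow>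
    one_term Q p \<phi> v z (proj x) = one_term W p (\<lambda>x. \<phi> (proj x)) v z x"
  by (simp add: one_term_def mode_proj)

lemma product_term_proj:
  "\<lbrakk>u \<in> carrier V; v \<in> carrier V; x \<in> carrier W\<rbrakk> \<Longrightarrow>
    product_term Q p \<phi> u z1 v z2 (proj x) = product_term W p (\<lambda>x. \<phi> (proj x)) u z1 v z2 x"
  by (simp add: product_term_def mode_proj mode_carrier)

lemma iterate_term_proj:
  "\<lbrakk>\<And>j. modeV V u j v \<in> carrier V; x \<in> carrier W\<rbrakk> \<Longrightarrow>
    iterate_term V Q p \<phi> u z1 v z2 (proj x) = iterate_term V W p (\<lambda>x. \<phi> (proj x)) u z1 v z2 x"
  by (simp add: iterate_term_def mode_proj)

text \<open>The algebraic identities are pushed forward along \<open>proj\<close>. In equivariance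
  and duality every term of a series for the quotient equals the term for W and the pulled-back
  functional, so the same \<open>F\<close>, \<open>a\<close> and \<open>T\<close> work.\<close>

theorem lower_bounded_twisted_module_Q: "lower_bounded_twisted_module V g Q"
proof -
  interpret V: grading_restricted_vertex_superalgebra V by (rule vsa)
  interpret VS: complex_vs V by (rule complex_vs.intro[OF V.space])
  have gV: "g v \<in> carrier V" if "v \<in> carrier V" for v
    using automorphism that by (simp add: vsa_automorphism_def linear_op_def)
  have parV: "u \<in> carrier V" if "u \<in> parV V s" for u s
    using V.fermion_grading that by (auto simp: direct_sum_on_def)
  have mV: "modeV V u j v \<in> carrier V" if "u \<in> carrier V" "v \<in> carrier V" for u j v
    using V.mode_linear_right that by (simp add: linear_op_def)
  have vacV: "vacV V \<in> carrier V" using V.vacuum_homogeneous parV by blast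
  have L0V: "L0V V v \<in> carrier V" "Lm1V V v \<in> carrier V" if "v \<in> carrier V" for v
    using V.L0_linear V.Lm1_linear that by (simp_all add: linear_op_def)
  have W: "L0W W x \<in> carrier W" "Lm1W W x \<in> carrier W" "gW W x \<in> carrier W" if "x \<in> carrier W" for x
    using U.linear_op_carrier L0_linear Lm1_linear g_linear that by blast+
  note s = L0_proj Lm1_proj g_proj mode_proj add_Q smult_Q LQ.diff[symmetric] mode_carrier W gV mV vacV L0V
  have ddxc: "ddxW W (\<lambda>n k. modeW W v n k x) n k \<in> carrier W"
    if "v \<in> carrier V" "x \<in> carrier W" for v x n k
    using that by (simp add: ddxW_def mode_carrier)
  show ?thesis
  proof (rule lower_bounded_twisted_module.intro)
    show "grading_restricted_vertex_superalgebra V" by (rule vsa)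
    show "vsa_automorphism V g" by (rule automorphism)
    show "complex_space Q" by (rule complex_space_Q)
    show "direct_sum_on Q (carrier Q) UNIV (parW Q)"
      using PQ.direct_sum by (simp add: parW_Q[abs_def])
    show "direct_sum_on Q (carrier Q) hom_index (hom_space Q)" by (rule grading_Q)
    show "\<exists>B. \<forall>n. Re n < B \<longrightarrow> wt_space Q n = {\<zero>\<^bsub>Q\<^esub>}" by (rule lower_bound_Q)
    show "linear_op Q (gW Q)" by (rule g_linear_Q)
    show "bij_betw (gW Q) (carrier Q) (carrier Q)" by (rule g_bij_Q)
    show "exp_form Q" by (rule exp_form_Q)
    show "linear_op Q (L0W Q)" by (rule L0_linear_Q)
    show "linear_op Q (Lm1W Q)" by (rule Lm1_linear_Q)
    show "linear_op Q (modeW Q v n k)" if "v \<in> carrier V" for v n k by (rule mode_linear_Q[OF that])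
  next
    fix y assume "y \<in> carrier Q"
    then obtain x where x: "x \<in> carrier W" "y = proj x" by (rule Q_cases)
    show "L0W Q (Lm1W Q y) \<ominus>\<^bsub>Q\<^esub> Lm1W Q (L0W Q y) = Lm1W Q y"
      using x by (simp add: s L0_Lm1)
    fix n k
    show "modeW Q (vacV V) n k y = (if n = -1 \<and> k = 0 then y else \<zero>\<^bsub>Q\<^esub>)"
      using x by (simp add: s identity proj_zero)
  next
    fix u v n k y assume uv: "u \<in> carrier V" "v \<in> carrier V" and "y \<in> carrier Q"
    then obtain x where x: "x \<in> carrier W" "y = proj x" by (blast elim: Q_cases)
    show "modeW Q (u \<oplus>\<^bsub>V\<^esub> v) n k y = modeW Q u n k y \<oplus>\<^bsub>Q\<^esub> modeW Q v n k y"
      using x uv by (simp add: s mode_add_left)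
  next
    fix c v n k y assume v: "v \<in> carrier V" and "y \<in> carrier Q"
    then obtain x where x: "x \<in> carrier W" "y = proj x" by (blast elim: Q_cases)
    show "modeW Q (c \<odot>\<^bsub>V\<^esub> v) n k y = c \<odot>\<^bsub>Q\<^esub> modeW Q v n k y"
      using x v by (simp add: s mode_smult_left)
  next
    fix v y assume v: "v \<in> carrier V" and "y \<in> carrier Q"
    then obtain x where x: "x \<in> carrier W" "y = proj x" by (blast elim: Q_cases)
    obtain K where "\<forall>k>K. \<forall>n. modeW W v n k x = \<zero>\<^bsub>W\<^esub>" using log_polynomial[OF v x(1)] by blast
    then show "\<exists>K. \<forall>k>K. \<forall>n. modeW Q v n k y = \<zero>\<^bsub>Q\<^esub>"
      using x v by (intro exI[of _ K]) (simp add: s proj_zero)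
  next
    fix s t v y n k assume v: "v \<in> parV V s" and "y \<in> parW Q t"
    then obtain x where x: "x \<in> parW W t" "y = proj x" by (auto simp: parW_Q)
    moreover have "x \<in> carrier W" using P.carrier x(1) by blast
    ultimately show "modeW Q v n k y \<in> parW Q (s + t)"
      using mode_even[OF v x(1), of n k] parV[OF v] by (simp add: parW_Q mode_proj)
  next
    fix v y n k assume v: "v \<in> carrier V" and "y \<in> carrier Q"
    then obtain x where x: "x \<in> carrier W" "y = proj x" by (blast elim: Q_cases)
    show "gW Q (modeW Q v n k y) = modeW Q (g v) n k (gW Q y)"
      using x v by (simp add: s g_compat)
    show "L0W Q (modeW Q v n k y) \<ominus>\<^bsub>Q\<^esub> modeW Q v n k (L0W Q y) =
      ddxW Q (\<lambda>n k. modeW Q v n k y) (n + 1) k \<oplus>\<^bsub>Q\<^esub> modeW Q (L0V V v) n k y"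
      unfolding x(2) ddxW_proj[OF v x(1)] using x v by (simp add: s L0_commutator ddxc)
    show "ddxW Q (\<lambda>n k. modeW Q v n k y) n k = modeW Q (Lm1V V v) n k y"
      unfolding x(2) ddxW_proj[OF v x(1)] using x v by (simp add: s Lm1_derivative)
    show "ddxW Q (\<lambda>n k. modeW Q v n k y) n k =
      Lm1W Q (modeW Q v n k y) \<ominus>\<^bsub>Q\<^esub> modeW Q v n k (Lm1W Q y)"
      unfolding x(2) ddxW_proj[OF v x(1)] using x v by (simp add: s Lm1_commutator)
  next
    fix p \<phi> v and z :: complex and y
    assume \<phi>: "\<phi> \<in> graded_dual Q" and v: "v \<in> carrier V" and y: "y \<in> carrier Q" and z: "z \<noteq> 0"
    obtain x where x: "x \<in> carrier W" "y = proj x" using y by (rule Q_cases)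
    show "(\<Sum>\<^sub>\<infinity>i. one_term Q (p + 1) \<phi> (g v) z y i) = (\<Sum>\<^sub>\<infinity>i. one_term Q p \<phi> v z y i)"
      unfolding x(2) one_term_proj[OF v x(1)] one_term_proj[OF gV[OF v] x(1)]
      by (rule equivariance[OF graded_dual_proj[OF \<phi>] v x(1) z])
  next
    fix s t u v y \<phi>
    assume u: "u \<in> parV V s" and v: "v \<in> parV V t" and y: "y \<in> carrier Q" and \<phi>: "\<phi> \<in> graded_dual Q"
    obtain x where x: "x \<in> carrier W" "y = proj x" using y by (rule Q_cases)
    note uv = parV[OF u] parV[OF v]
    show "\<exists>F a T. finite F \<and> (\<forall>p z1 z2.
        (cmod z1 > cmod z2 \<and> cmod z2 > 0 \<longrightarrow>
          abs_sums_to (product_term Q p \<phi> u z1 v z2 y) (corr_branch F a T p z1 z2)) \<and>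
        (cmod z2 > cmod z1 \<and> cmod z1 > 0 \<longrightarrow>
          abs_sums_to (\<lambda>i. super_sign s t * product_term Q p \<phi> v z2 u z1 y i)
            (corr_branch F a T p z1 z2)) \<and>
        (cmod z2 > cmod (z1 - z2) \<and> cmod (z1 - z2) > 0 \<longrightarrow>
          (\<exists>c. abs_sums_to (iterate_term V Q p \<phi> u z1 v z2 y) c) \<and>
          (\<bar>Arg2pi z1 - Arg2pi z2\<bar> < pi / 2 \<longrightarrow>
            abs_sums_to (iterate_term V Q p \<phi> u z1 v z2 y) (corr_branch F a T p z1 z2))))"
      unfolding x(2) product_term_proj[OF uv x(1)] product_term_proj[OF uv(2,1) x(1)]
        iterate_term_proj[OF mV[OF uv] x(1)]
      by (rule duality[OF u v x(1) graded_dual_proj[OF \<phi>]])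
  qed
qed

end

section \<open>Submodules of the quotient\<close>

lemma (in twisted_quotient) twisted_submodule_vimage:
  assumes K: "twisted_submodule V Q K"
  shows "twisted_submodule V W {x \<in> carrier W. proj x \<in> K}"
proof -
  interpret QM: lower_bounded_twisted_module V g Q by (rule lower_bounded_twisted_module_Q)
  \<comment> \<open>\<open>QM\<close> expresses gradedness through the intrinsic homogeneous
    subspaces, \<open>GQ\<close> through the images; only the latter projections are tied to W by
    \<open>proj_component\<close>.\<close>
  have comp: "component Q hom_index (hom_space Q) = GQ.pr"
    by (rule component_cong) (rule hom_space_Q)
  note K' = K[unfolded QM.twisted_submodule_iff comp]
  have sub: "subspace_of K Q" using K' by blast
  show ?thesis
    unfolding twisted_submodule_iff
  proof (intro conjI ballI allI)
    show "subspace_of {x \<in> carrier W. proj x \<in> K} W"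
      unfolding U.subspace_iff
      using LQ.B.subspace_zero[OF sub] LQ.B.subspace_add[OF sub] LQ.B.subspace_smult[OF sub]
      by (auto simp: proj_zero simp flip: add_Q smult_Q)
  next
    fix x i assume "x \<in> {x \<in> carrier W. proj x \<in> K}" and i: "i \<in> hom_index"
    then have x: "x \<in> carrier W" "proj x \<in> K" by auto
    then have "GQ.pr i (proj x) \<in> K" using K' i by blast
    then show "G.pr i x \<in> {x \<in> carrier W. proj x \<in> K}"
      unfolding proj_component[OF x(1) i] using x(1) i by simp
  next
    fix v n k x assume v: "v \<in> carrier V" and "x \<in> {x \<in> carrier W. proj x \<in> K}"
    then have x: "x \<in> carrier W" "proj x \<in> K" by auto
    then have "modeW Q v n k (proj x) \<in> K" using K' v by blast
    then show "modeW W v n k x \<in> {x \<in> carrier W. proj x \<in> K}"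
      unfolding mode_proj[OF v x(1)] using v x(1) by (simp add: mode_carrier)
  next
    fix x assume "x \<in> {x \<in> carrier W. proj x \<in> K}"
    then have x: "x \<in> carrier W" "proj x \<in> K" by auto
    then have "L0W Q (proj x) \<in> K" "Lm1W Q (proj x) \<in> K" "gW Q (proj x) \<in> K" using K' by blast+
    then show "L0W W x \<in> {x \<in> carrier W. proj x \<in> K}" "Lm1W W x \<in> {x \<in> carrier W. proj x \<in> K}"
      "gW W x \<in> {x \<in> carrier W. proj x \<in> K}"
      unfolding L0_proj[OF x(1)] Lm1_proj[OF x(1)] g_proj[OF x(1)]
      using x(1) U.linear_op_carrier L0_linear Lm1_linear g_linear by blast+
  qed
qed

lemma (in twisted_quotient) irreducible_quotient:
  assumes max: "maximal_submodule V W J"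
  shows "irreducible_twisted_module V g Q"
  unfolding irreducible_twisted_module_def
proof (intro conjI allI impI)
  show "lower_bounded_twisted_module V g Q" by (rule lower_bounded_twisted_module_Q)
  have "J \<noteq> carrier W" using max by (simp add: maximal_submodule_def)
  then obtain x where x: "x \<in> carrier W" "x \<notin> J" using J_carrier by blast
  then have "proj x \<noteq> \<zero>\<^bsub>Q\<^esub>" using LQ.kernel by blast
  then show "carrier Q \<noteq> {\<zero>\<^bsub>Q\<^esub>}" using x(1) carrier_Q by blast
  fix K assume K: "twisted_submodule V Q K"
  let ?L = "{x \<in> carrier W. proj x \<in> K}"
  have sub: "subspace_of K Q" using K by (simp add: twisted_submodule_def)
  have "K \<subseteq> proj ` carrier W" using LQ.B.subspace_carrier[OF sub] unfolding carrier_Q by auto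
  \<comment> \<open>Surjectivity of \<open>proj\<close> recovers K from its preimage.\<close>
  then have KL: "K = proj ` ?L" by auto
  have J0: "proj x = \<zero>\<^bsub>Q\<^esub>" if "x \<in> J" for x using LQ.kernel[OF J_carrier[OF that]] that by blast
  then have "J \<subseteq> ?L" using J_carrier LQ.B.subspace_zero[OF sub] by auto
  then have "?L = J \<or> ?L = carrier W"
    using max twisted_submodule_vimage[OF K] unfolding maximal_submodule_def by blast
  then show "K = {\<zero>\<^bsub>Q\<^esub>} \<or> K = carrier Q"
  proof
    assume "?L = J"
    then have "K = proj ` J" using KL by simp
    then have "K \<subseteq> {\<zero>\<^bsub>Q\<^esub>}" using J0 by blast
    then show ?thesis using LQ.B.subspace_zero[OF sub] by blast
  next
    assume "?L = carrier W"
    then show ?thesis using KL carrier_Q by simp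
  qed
qed

section \<open>Maximal submodules\<close>

context lower_bounded_twisted_module
begin

lemma twisted_submodule_zero: "twisted_submodule V W {\<zero>\<^bsub>W\<^esub>}"
  unfolding twisted_submodule_iff U.subspace_iff
  using U.linear_op_zero L0_linear Lm1_linear g_linear mode_linear_right by auto

text \<open>Comparability keeps sums in the union; in the form of
  \<open>twisted_submodule_iff\<close> gradedness and invariance concern one element at a time. The
  empty chain is excluded because its union lacks zero.\<close>

lemma twisted_submodule_Union_chain:
  assumes "\<C> \<noteq> {}" "subset.chain {J. twisted_submodule V W J} \<C>"
  shows "twisted_submodule V W (\<Union>\<C>)"
proof -
  have sub: "twisted_submodule V W J" if "J \<in> \<C>" for J
    using assms(2) that by (auto simp: subset.chain_def)
  then have J: "subspace_of J W" if "J \<in> \<C>" for J using that by (simp add: twisted_submodule_def)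
  have "subspace_of (\<Union>\<C>) W"
    unfolding U.subspace_iff
  proof (intro conjI ballI allI)
    show "\<Union>\<C> \<subseteq> carrier W" using J U.subspace_carrier by blast
    show "\<zero>\<^bsub>W\<^esub> \<in> \<Union>\<C>" using J U.subspace_zero assms(1) by blast
    fix x y assume "x \<in> \<Union>\<C>" "y \<in> \<Union>\<C>"
    then obtain A B where AB: "A \<in> \<C>" "B \<in> \<C>" "x \<in> A" "y \<in> B" by blast
    then have "A \<subseteq> B \<or> B \<subseteq> A" using assms(2) by (auto simp: subset.chain_def)
    then show "x \<oplus>\<^bsub>W\<^esub> y \<in> \<Union>\<C>"
      using AB U.subspace_add[OF J[OF AB(1)], of x y] U.subspace_add[OF J[OF AB(2)], of x y] by blast
  next
    fix c x assume "x \<in> \<Union>\<C>"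
    then show "c \<odot>\<^bsub>W\<^esub> x \<in> \<Union>\<C>" using J U.subspace_smult by blast
  qed
  then show ?thesis
    using sub unfolding twisted_submodule_iff by (intro conjI ballI allI; blast)
qed

text \<open>Stability under L(0), L(-1) and all modes puts the whole spanning set into K, and
  \<open>linspan\<close> is the smallest subspace containing that set.\<close>

lemma twisted_submodule_eq_carrier:
  assumes K: "twisted_submodule V W K" and w: "w \<in> K" and gen: "generated_by V W {w}"
  shows "K = carrier W"
proof
  have sub: "subspace_of K W" using K by (simp add: twisted_submodule_def)
  then show "K \<subseteq> carrier W" by (rule U.submoduleE(1))
  have L0: "(L0W W ^^ q) w \<in> K" for q
    using K w by (induction q) (auto simp: twisted_submodule_def)
  have "(Lm1W W ^^ p) ((L0W W ^^ q) w) \<in> K" for p q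
    using K L0 by (induction p) (auto simp: twisted_submodule_def)
  then have "{modeW W v n k ((Lm1W W ^^ p) ((L0W W ^^ q) w')) | v n k p q w'. v \<in> carrier V \<and> w' \<in> {w}} \<subseteq> K"
    using K by (auto simp: twisted_submodule_def)
  then have "linspan W {modeW W v n k ((Lm1W W ^^ p) ((L0W W ^^ q) w')) | v n k p q w'. v \<in> carrier V \<and> w' \<in> {w}} \<subseteq> K"
    unfolding linspan_def by (rule hull_minimal) (rule sub)
  then show "carrier W \<subseteq> K" using gen by (simp add: generated_by_def)
qed

end

theorem theorem4p7:
  fixes V :: "'v vsa_data" and g :: "'v \<Rightarrow> 'v" and W :: "('v, 'w) twisted_data" and w :: 'w
  assumes "grading_restricted_vertex_superalgebra V"
    and "vsa_automorphism V g"
    and "lower_bounded_twisted_module V g W"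
    and "w \<in> carrier W" and "w \<noteq> \<zero>\<^bsub>W\<^esub>"
    and "generated_by V W {w}"
  shows "\<exists>J. maximal_submodule V W J \<and> w \<notin> J \<and>
    irreducible_twisted_module V g (quotient_data W J)"
proof -
  interpret lower_bounded_twisted_module V g W by fact
  let ?A = "{J. twisted_submodule V W J \<and> w \<notin> J}"
  have "\<exists>J\<in>?A. \<forall>K\<in>?A. J \<subseteq> K \<longrightarrow> K = J"
  proof (rule subset_Zorn_nonempty)
    \<comment> \<open>This is where \<open>w\<close> being nonzero enters: the zero submodule avoids
      it.\<close>
    show "?A \<noteq> {}" using twisted_submodule_zero assms(5) by blast
    fix \<C> assume \<C>: "\<C> \<noteq> {}" "subset.chain ?A \<C>"
    then have "subset.chain {J. twisted_submodule V W J} \<C>" by (auto simp: subset.chain_def)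
    then have "twisted_submodule V W (\<Union>\<C>)" using twisted_submodule_Union_chain[OF \<C>(1)] by blast
    moreover have "w \<notin> \<Union>\<C>" using \<C>(2) by (auto simp: subset.chain_def)
    ultimately show "\<Union>\<C> \<in> ?A" by blast
  qed
  then obtain J where J: "twisted_submodule V W J" "w \<notin> J"
    and max: "\<And>K. \<lbrakk>twisted_submodule V W K; w \<notin> K; J \<subseteq> K\<rbrakk> \<Longrightarrow> K = J"
    by blast
  interpret twisted_quotient V g W J
    by (intro twisted_quotient.intro twisted_quotient_axioms.intro J(1) assms(3))
  have "maximal_submodule V W J"
    unfolding maximal_submodule_def
  proof (intro conjI allI impI)
    fix K assume "twisted_submodule V W K \<and> J \<subseteq> K"
    then show "K = J \<or> K = carrier W"
      using max[of K] twisted_submodule_eq_carrier[OF _ _ assms(6), of K] by blast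
  qed (use J assms(4) in auto)
  then show ?thesis using J(2) irreducible_quotient by blast
qed

end
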